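(* Fix an error tolerance $\varepsilon>0$. Suppose Assumptions 1--5 of the context hold, and let $\boldsymbol\pi^*$ be the solution of the optimization problem $$\min_{\boldsymbol\pi}\ \hat t_\varepsilon^{\boldsymbol\pi},\qquad \hat t_\varepsilon^{\boldsymbol\pi}=\mathbb E\big[\|\boldsymbol h_\varepsilon(\boldsymbol\pi(C))\|\big]\;\mathbb E\big[d(\tau,\boldsymbol\pi(C),C)\big],$$ over all state-dependent stationary policies $\boldsymbol\pi:\mathcal C\to[0,q_{\max}]^m$, where $C\sim\mu$. For $0<\beta<1$ let $\hat R^{n}_{\varepsilon,\beta}$ and $\hat D^{n}_{\beta}$ be the estimates produced at round $n$ by the NAC-FL algorithm (defined in the context) executed without termination with constant step size $\beta_n=\beta$ for all $n$ on the random network state sequence $(C^n)_n$. Then there exists a positive sequence $(\beta_i)_{i\ge1}$ with $\beta_i\to0$ as $i\to\infty$ such that for every $\rho>0$ there exists a threshold $n_{th}(\rho)$ with $$\lim_{i\to\infty}\ \sup_{n\ge n_{th}(\rho)/\beta_i} P\left(\left\|\begin{pmatrix}\hat R^{n}_{\varepsilon,\beta_i}-\mathbb E[\|\boldsymbol h_\varepsilon(\boldsymbol\pi^*(C))\|]\\ \hat D^{n}_{\beta_i}-\mathbb E[d(\tau,\boldsymbol\pi^*(C),C)]\end{pmatrix}\right\|>\rho\right)=0 .$$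
   Context: Setting. There are $m$ clients, a finite set $\mathcal C$ of network states, a bound $q_{\max}>0$, and a fixed number $\tau$ of local computations per round. A federated learning (FL) algorithm runs in rounds $n=1,2,\dots$; in round $n$ the clients use a vector of compression parameters $\boldsymbol q^{n}\in[0,q_{\max}]^m$, the network state is $c^{n}\in\mathcal C$, and the round has duration $d(\tau,\boldsymbol q^{n},c^{n})>0$. Assumption 1. For the given FL algorithm there exist a strictly increasing, continuous, bounded function $h_\varepsilon:[0,q_{\max}]\to\mathbb R^+$ and a norm $\|\cdot\|$ on $\mathbb R^m$ such that, with $\boldsymbol h_\varepsilon(\boldsymbol q)=(h_\varepsilon(q_1),\dots,h_\varepsilon(q_m))$, given any sequence $(\boldsymbol q^{n})_n$ of compression parameters the algorithm has reached error tolerance $\varepsilon$ by round $r$ if and only if $r>\frac1r\sum_{n=1}^r\|\boldsymbol h_\varepsilon(\boldsymbol q^{n})\|$. $\boldsymbol h_\varepsilon^{-1}$ denotes the (coordinatewise) inverse of $\boldsymbol h_\varepsilon$. Assumption 2. For any sequence of compression parameters, the minimum number of rounds $r_\varepsilon$ needed to reach error tolerance $\varepsilon$ satisfies $r_\varepsilon=\Theta(1/\mathrm{poly}(\varepsilon))$ (as $\varepsilon\to0$), where $\mathrm{poly}(\varepsilon)$ is a polynomial in $\varepsilon$ (so the number of rounds grows as $\varepsilon\to 0$). Assumption 3. For each network state $c$ and $\tau$, the map $\boldsymbol r\mapsto d(\tau,\boldsymbol h_\varepsilon^{-1}(\boldsymbol r),c)$ is bounded, convex in $\boldsymbol r$,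 and decreasing in every coordinate of $\boldsymbol r$. Assumption 4. The sequence of network states $(C^{n})_n$ is an irreducible aperiodic stationary Markov chain on the finite set $\mathcal C$ with invariant distribution $\mu$. Assumption 5. Represent a state-dependent stationary policy $\boldsymbol\pi:\mathcal C\to[0,q_{\max}]^m$ by the vector $\underline{\boldsymbol\pi}$ of dimension $m|\mathcal C|$ listing its values, and let $\boldsymbol r^{\underline{\boldsymbol\pi}}$ be the vector obtained by applying $h_\varepsilon$ to each entry of $\underline{\boldsymbol\pi}$. The objective $\hat t_\varepsilon^{\boldsymbol\pi}$ is a strictly quasiconvex function in $\boldsymbol\pi$ in the following sense: $(\boldsymbol r^{\underline{\boldsymbol\pi}})^\top\big(\nabla_{\boldsymbol r^{\underline{\boldsymbol\pi}}}\hat t_\varepsilon^{\boldsymbol\pi}\big)=0$ implies $(\boldsymbol r^{\underline{\boldsymbol\pi}})^\top\big(\nabla^2_{\boldsymbol r^{\underline{\boldsymbol\pi}}}\hat t_\varepsilon^{\boldsymbol\pi}\big)\boldsymbol r^{\underline{\boldsymbol\pi}}>0$. NAC-FL algorithm (with parameter $\alpha=1$). Given positive initial values $\hat r^{0},\hat d^{0}$ and step sizes $\beta_n$, for $n=1,2,\dots$: observe the network state $c^{n}$; choose $\boldsymbol q^{n}\in\arg\min_{\boldsymbol q\in[0,q_{\max}]^m}\ \hat r^{n-1}d(\tau,\boldsymbol q,c^{n})+\hat d^{\,n-1}\|\boldsymbol h_\varepsilon(\boldsymbol q)\|$; set $\hat r^{n}=(1-\beta_n)\hat r^{n-1}+\beta_n\|\boldsymbol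 h_\varepsilon(\boldsymbol q^{n})\|$ and $\hat d^{\,n}=(1-\beta_n)\hat d^{\,n-1}+\beta_n d(\tau,\boldsymbol q^{n},c^{n})$. With $\beta_n=\beta$ and random states $C^n$, these estimates are denoted $\hat R^n_{\varepsilon,\beta}$ and $\hat D^n_\beta$.
   Formalization: Assumption 5 is required in every direction: y^T∇t=0 with y≠0 implies y^T∇²t y>0 (standard second-order strict quasiconvexity), not only for y=r^π; with y=r^π alone the claim is false, as NAC-FL can stay near a non-optimal local minimum. *)

theory Defs
  imports "HOL-Probability.Probability" "HOL-Library.Landau_Symbols"
    "HOL-Computational_Algebra.Polynomial"
begin

text \<open>
  The $m$ clients are the elements of a finite index type and the network states are the
  elements of a finite type.  Rounds are numbered from 1, so the value at index 0 of a sequence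
  of compression parameters or of network states is never used.
\<close>

definition qbox :: "real \<Rightarrow> (real ^ 'm) set" where
  "qbox qmax = {q. \<forall>i. q $ i \<in> {0..qmax}}"

definition hvec :: "(real \<Rightarrow> real) \<Rightarrow> real ^ 'm \<Rightarrow> real ^ 'm" where
  "hvec h q = (\<chi> i. h (q $ i))"

definition hinv :: "real \<Rightarrow> (real \<Rightarrow> real) \<Rightarrow> real ^ 'm \<Rightarrow> real ^ 'm" where
  "hinv qmax h r = (\<chi> i. inv_into {0..qmax} h (r $ i))"

definition is_norm :: "('v :: real_vector \<Rightarrow> real) \<Rightarrow> bool" where
  "is_norm N \<longleftrightarrow>
     (\<forall>x. 0 \<le> N x) \<and> (\<forall>x. N x = 0 \<longleftrightarrow> x = 0) \<and>
     (\<forall>a x. N (a *\<^sub>R x) = \<bar>a\<bar> * N x) \<and> (\<forall>x y. N (x + y) \<le> N x + N y)"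

text \<open>
  \<open>reached \<epsilon> q r\<close> stands for: with compression parameters \<open>q 1, q 2, \<dots>\<close>, the algorithm has
  reached error tolerance \<open>\<epsilon>\<close> by round \<open>r\<close>.  The family \<open>h\<close> is indexed by the tolerance;
  the norm \<open>N\<close> does not depend on it.
\<close>

definition rounds_model ::
  "real \<Rightarrow> (real ^ 'm \<Rightarrow> real) \<Rightarrow> (real \<Rightarrow> real \<Rightarrow> real) \<Rightarrow>
   (real \<Rightarrow> (nat \<Rightarrow> real ^ 'm) \<Rightarrow> nat \<Rightarrow> bool) \<Rightarrow> bool" where
  "rounds_model qmax N h reached \<longleftrightarrow>
     is_norm N \<and>
     (\<forall>\<epsilon>>0.
        strict_mono_on {0..qmax} (h \<epsilon>) \<and> continuous_on {0..qmax} (h \<epsilon>) \<and>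
        bounded (h \<epsilon> ` {0..qmax}) \<and> (\<forall>x\<in>{0..qmax}. 0 < h \<epsilon> x) \<and>
        (\<forall>q. (\<forall>n\<ge>1. q n \<in> qbox qmax) \<longrightarrow>
           (\<forall>r\<ge>1. reached \<epsilon> q r \<longleftrightarrow>
              real r > (1 / real r) * (\<Sum>n=1..r. N (hvec (h \<epsilon>) (q n))))))"

text \<open>
  The polynomial vanishes at 0 because the number of rounds is to grow as the tolerance tends
  to 0; it and the implied constants may depend on the sequence of compression parameters.
\<close>

definition rounds_growth ::
  "real \<Rightarrow> (real \<Rightarrow> (nat \<Rightarrow> real ^ 'm) \<Rightarrow> nat \<Rightarrow> bool) \<Rightarrow> bool" where
  "rounds_growth qmax reached \<longleftrightarrow>
     (\<forall>q. (\<forall>n\<ge>1. q n \<in> qbox qmax) \<longrightarrow>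
        (\<exists>p :: real poly. p \<noteq> 0 \<and> poly p 0 = 0 \<and>
           (\<lambda>\<epsilon>. real (LEAST r. 1 \<le> r \<and> reached \<epsilon> q r)) \<in> \<Theta>[at_right 0](\<lambda>\<epsilon>. 1 / poly p \<epsilon>)))"

definition decreasing_in_each_coordinate :: "(real ^ 'm) set \<Rightarrow> (real ^ 'm \<Rightarrow> real) \<Rightarrow> bool" where
  "decreasing_in_each_coordinate S f \<longleftrightarrow>
     (\<forall>x\<in>S. \<forall>y\<in>S. \<forall>i. (\<forall>j. j \<noteq> i \<longrightarrow> x $ j = y $ j) \<and> x $ i \<le> y $ i \<longrightarrow> f y \<le> f x)"

text \<open>Here and below \<open>dur q c\<close> is the duration of a round for the fixed number of local computations.\<close>

definition duration_regular ::
  "real \<Rightarrow> (real \<Rightarrow> real) \<Rightarrow> (real ^ 'm \<Rightarrow> 'c \<Rightarrow> real) \<Rightarrow> bool" where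
  "duration_regular qmax h dur \<longleftrightarrow>
     (\<forall>c. let S = hvec h ` qbox qmax; f = (\<lambda>r. dur (hinv qmax h r) c) in
        bounded (f ` S) \<and> convex_on S f \<and> decreasing_in_each_coordinate S f)"

definition kernel_power :: "('c \<Rightarrow> 'c pmf) \<Rightarrow> nat \<Rightarrow> 'c \<Rightarrow> 'c pmf" where
  "kernel_power K n x = ((\<lambda>p. bind_pmf p K) ^^ n) (return_pmf x)"

definition irreducible_kernel :: "('c \<Rightarrow> 'c pmf) \<Rightarrow> bool" where
  "irreducible_kernel K \<longleftrightarrow> (\<forall>x y. \<exists>n. 0 < pmf (kernel_power K n x) y)"

definition aperiodic_kernel :: "('c \<Rightarrow> 'c pmf) \<Rightarrow> bool" where
  "aperiodic_kernel K \<longleftrightarrow> (\<forall>x. Gcd {n. 1 \<le> n \<and> 0 < pmf (kernel_power K n x) x} = 1)"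

definition markov_chain :: "'w measure \<Rightarrow> ('c \<Rightarrow> 'c pmf) \<Rightarrow> (nat \<Rightarrow> 'w \<Rightarrow> 'c) \<Rightarrow> bool" where
  "markov_chain M K C \<longleftrightarrow>
     prob_space M \<and>
     (\<forall>n\<ge>1. C n \<in> measurable M (count_space UNIV)) \<and>
     (\<forall>n\<ge>1. \<forall>s. \<P>(\<omega> in M. \<forall>k\<in>{1..n}. C k \<omega> = s k) > 0 \<longrightarrow>
        \<P>(\<omega> in M. C (Suc n) \<omega> = s (Suc n) \<bar> \<forall>k\<in>{1..n}. C k \<omega> = s k) = pmf (K (s n)) (s (Suc n)))"

text \<open>Stationarity: the initial state has the invariant distribution.\<close>

definition stationary_ergodic_chain ::
  "'w measure \<Rightarrow> ('c \<Rightarrow> 'c pmf) \<Rightarrow> 'c pmf \<Rightarrow> (nat \<Rightarrow> 'w \<Rightarrow> 'c) \<Rightarrow> bool" where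
  "stationary_ergodic_chain M K \<mu> C \<longleftrightarrow>
     markov_chain M K C \<and> irreducible_kernel K \<and> aperiodic_kernel K \<and>
     bind_pmf \<mu> K = \<mu> \<and> distr M (count_space UNIV) (C 1) = measure_pmf \<mu>"

definition policies :: "real \<Rightarrow> ('c \<Rightarrow> real ^ 'm) set" where
  "policies qmax = {\<pi>. \<forall>c. \<pi> c \<in> qbox qmax}"

definition mean_rounds ::
  "(real ^ 'm \<Rightarrow> real) \<Rightarrow> (real \<Rightarrow> real) \<Rightarrow> 'c pmf \<Rightarrow> ('c \<Rightarrow> real ^ 'm) \<Rightarrow> real" where
  "mean_rounds N h \<mu> \<pi> = measure_pmf.expectation \<mu> (\<lambda>c. N (hvec h (\<pi> c)))"

definition mean_duration ::
  "(real ^ 'm \<Rightarrow> 'c \<Rightarrow> real) \<Rightarrow> 'c pmf \<Rightarrow> ('c \<Rightarrow> real ^ 'm) \<Rightarrow> real" where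
  "mean_duration dur \<mu> \<pi> = measure_pmf.expectation \<mu> (\<lambda>c. dur (\<pi> c) c)"

definition t_hat ::
  "(real ^ 'm \<Rightarrow> real) \<Rightarrow> (real \<Rightarrow> real) \<Rightarrow> (real ^ 'm \<Rightarrow> 'c \<Rightarrow> real) \<Rightarrow> 'c pmf \<Rightarrow>
   ('c \<Rightarrow> real ^ 'm) \<Rightarrow> real" where
  "t_hat N h dur \<mu> \<pi> = mean_rounds N h \<mu> \<pi> * mean_duration dur \<mu> \<pi>"

text \<open>
  Second-order strict quasiconvexity: wherever the derivative of \<open>f\<close> in a direction \<open>y\<close>
  vanishes, the second derivative in that direction is positive.  \<open>g\<close> is the gradient and \<open>H\<close>
  the Hessian; derivatives are taken within \<open>S\<close>, i.e. they are one-sided at boundary points,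
  and are unique when \<open>S\<close> is a box with nonempty interior.

  The direction \<open>y\<close> must range over all nonzero vectors.  If it is restricted to \<open>y = x\<close>, only
  the behaviour of \<open>f\<close> along rays from the origin is controlled, and convergence to the optimum
  fails: take one network state, two clients, the norm $|r_1| + |r_2|$, $h$ with range
  $[0.9, 1.1]$, and duration $4 - r_1 - r_2 + 3 (r_2 - 1)^2$.  The product of norm and duration is
  concave in $r_1$, with local minima for $r_1 = 0.9$ and $r_1 = 1.1$, and the choice of
  parameters made by the algorithm keeps the estimates near the one they start at.
\<close>

definition strictly_quasiconvex_on :: "'v :: euclidean_space set \<Rightarrow> ('v \<Rightarrow> real) \<Rightarrow> bool" where
  "strictly_quasiconvex_on S f \<longleftrightarrow>
     (\<exists>g H. (\<forall>x\<in>S. (f has_derivative (\<lambda>y. y \<bullet> g x)) (at x within S) \<and>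
                    (g has_derivative H x) (at x within S)) \<and>
            (\<forall>x\<in>S. \<forall>y. y \<noteq> 0 \<and> y \<bullet> g x = 0 \<longrightarrow> 0 < y \<bullet> H x y))"

text \<open>
  The policy \<open>\<pi>\<close> is represented by the vector \<open>policy_vec h \<pi>\<close> with entries \<open>h (\<pi> c $ i)\<close>, and the
  objective is regarded as a function of this vector.
\<close>

definition policy_vec :: "(real \<Rightarrow> real) \<Rightarrow> ('c \<Rightarrow> real ^ 'm) \<Rightarrow> real ^ 'm ^ 'c" where
  "policy_vec h \<pi> = (\<chi> c. hvec h (\<pi> c))"

definition objective_quasiconvex ::
  "real \<Rightarrow> (real ^ 'm \<Rightarrow> real) \<Rightarrow> (real \<Rightarrow> real) \<Rightarrow> (real ^ 'm \<Rightarrow> 'c :: finite \<Rightarrow> real) \<Rightarrow>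
   'c pmf \<Rightarrow> bool" where
  "objective_quasiconvex qmax N h dur \<mu> \<longleftrightarrow>
     strictly_quasiconvex_on (policy_vec h ` policies qmax)
       (\<lambda>r. t_hat N h dur \<mu> (\<lambda>c. hinv qmax h (r $ c)))"

text \<open>
  \<open>c\<close> is the observed sequence of network states and \<open>\<beta>\<close> the sequence of step sizes; \<open>q\<close>, \<open>r\<close>, \<open>d\<close>
  are the chosen parameters and the two sequences of estimates.  Ties in the minimization may
  be broken arbitrarily.
\<close>

definition nac_fl_run ::
  "real \<Rightarrow> (real ^ 'm \<Rightarrow> real) \<Rightarrow> (real \<Rightarrow> real) \<Rightarrow> (real ^ 'm \<Rightarrow> 'c \<Rightarrow> real) \<Rightarrow>
   (nat \<Rightarrow> real) \<Rightarrow> real \<Rightarrow> real \<Rightarrow> (nat \<Rightarrow> 'c) \<Rightarrow>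
   (nat \<Rightarrow> real ^ 'm) \<Rightarrow> (nat \<Rightarrow> real) \<Rightarrow> (nat \<Rightarrow> real) \<Rightarrow> bool" where
  "nac_fl_run qmax N h dur \<beta> r0 d0 c q r d \<longleftrightarrow>
     r 0 = r0 \<and> d 0 = d0 \<and>
     (\<forall>n\<ge>1.
        is_arg_min (\<lambda>x. r (n - 1) * dur x (c n) + d (n - 1) * N (hvec h x))
          (\<lambda>x. x \<in> qbox qmax) (q n) \<and>
        r n = (1 - \<beta> n) * r (n - 1) + \<beta> n * N (hvec h (q n)) \<and>
        d n = (1 - \<beta> n) * d (n - 1) + \<beta> n * dur (q n) (c n))"

end

theory Submission
  imports Defs
begin

text \<open>
  The product of the two estimates is a Lyapunov function.  A choice of parameters minimizes the
  linearization \<open>R d + D N\<close> of the product \<open>R D\<close> at the current estimates.  Hence over a block of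
  \<open>k \<approx> \<delta> / \<beta>\<close> rounds in which the network states occur with frequencies close to the invariant
  distribution, the estimates approach the upper image of the convex map (mean rounds, mean
  duration) of policies, and their product decreases by an amount proportional to \<open>\<delta>\<close> unless
  they are close to a stationary point of the product.  Strict quasiconvexity leaves only one
  such point, the optimum.  So a bounded number \<open>J\<close> of such blocks leads from any starting point
  to a neighbourhood of the optimum, and this depends only on the last \<open>J k\<close> rounds before
  \<open>n\<close>.  A weak law of large numbers for the Markov chain bounds the probability that
  one of the \<open>J\<close> blocks is atypical, uniformly in \<open>n\<close>.
\<close>

text \<open>Two demands on the length of a block compete: the state frequencies must settle, and the
  estimates that weight the minimization must hardly move. With \<open>k * \<beta>\<close> close to
  a fixed \<open>\<delta>\<close> the movement is of order \<open>\<delta>\<close> for every step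
  size, while \<open>k\<close> grows as \<open>\<beta>\<close> tends to 0. The errors of averaging
  are thus bounded deterministically in terms of \<open>\<delta>\<close> and the frequency tolerance
  \<open>\<eta>\<close>; the only random statement is that the blocks are typical, and it fails with
  probability of order \<open>\<beta>\<close>.

  The initial values are arbitrary, so the estimates may lie below every achievable pair and their
  product below the minimum. A small product means closeness to the optimum only near the upper
  image; hence the number of blocks has two summands, one for the distance from the upper image and
  one for the decrease of the product.

  Strict quasiconvexity provides no rate: it only excludes other stationary points. The rate of
  decrease comes from compactness, applied to triples of a policy and the two estimates.\<close>

subsection \<open>Strict quasiconvexity and compactness\<close>

text \<open>If \<open>f y\<close> were at most \<open>f x\<close>, then \<open>f\<close> along the
  segment would attain its maximum at a point other than \<open>y\<close>. The derivative vanishes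
  there, so the second derivative is positive, which is impossible at a maximum with room to the
  right. The hypothesis on \<open>e\<close> says that \<open>f\<close> does not decrease to first
  order when leaving \<open>x\<close>; it settles the case of a maximum at \<open>x\<close>
  itself.\<close>

lemma strictly_quasiconvex_on_less:
  fixes f :: "'v::euclidean_space \<Rightarrow> real"
  assumes qc: "strictly_quasiconvex_on S f" and S: "convex S" "x \<in> S" "y \<in> S" "x \<noteq> y"
    and ge: "\<And>s. 0 < s \<Longrightarrow> s \<le> 1 \<Longrightarrow> f x - s * e s \<le> f (x + s *\<^sub>R (y - x))"
    and e: "(e \<longlongrightarrow> 0) (at_right 0)"
  shows "f x < f y"
proof (rule ccontr)
  assume "\<not> f x < f y"
  then have fyx: "f y \<le> f x" by simp
  from qc obtain g H where
    f': "\<And>x. x \<in> S \<Longrightarrow> (f has_derivative (\<lambda>y. y \<bullet> g x)) (at x within S)" and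
    g': "\<And>x. x \<in> S \<Longrightarrow> (g has_derivative H x) (at x within S)" and
    pos: "\<And>x y. x \<in> S \<Longrightarrow> y \<noteq> 0 \<Longrightarrow> y \<bullet> g x = 0 \<Longrightarrow> 0 < y \<bullet> H x y"
    unfolding strictly_quasiconvex_on_def by blast
  define v where "v = y - x"
  define z where "z s = x + s *\<^sub>R v" for s
  define \<phi> where "\<phi> s = f (z s)" for s
  define \<psi> where "\<psi> s = v \<bullet> g (z s)" for s
  have v: "v \<noteq> 0" using S by (simp add: v_def)
  have zS: "z s \<in> S" if "s \<in> {0..1}" for s
  proof -
    have "z s = (1 - s) *\<^sub>R x + s *\<^sub>R y" by (simp add: z_def v_def algebra_simps)
    then show ?thesis using S that by (auto simp: convex_alt)
  qed
  then have img: "z ` {0..1} \<subseteq> S" by blast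
  have z': "(z has_derivative (\<lambda>t. t *\<^sub>R v)) (at s within {0..1})" for s
    unfolding z_def by (auto intro!: derivative_eq_intros)
  have \<phi>': "(\<phi> has_real_derivative \<psi> s) (at s within {0..1})" if "s \<in> {0..1}" for s
    using diff_chain_within[OF z' has_derivative_subset[OF f'[OF zS[OF that]] img]]
    by (simp add: \<phi>_def[abs_def] \<psi>_def o_def has_field_derivative_def mult_commute_abs)
  have \<psi>': "(\<psi> has_real_derivative v \<bullet> H (z s) v) (at s within {0..1})" if "s \<in> {0..1}" for s
  proof -
    have lin: "linear (H (z s))" using g'[OF zS[OF that]] has_derivative_linear by blast
    have "((\<lambda>s. g (z s)) has_derivative (\<lambda>t. H (z s) (t *\<^sub>R v))) (at s within {0..1})"
      using diff_chain_within[OF z' has_derivative_subset[OF g'[OF zS[OF that]] img]]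
      by (simp add: o_def)
    then have "(\<psi> has_derivative (\<lambda>t. v \<bullet> H (z s) (t *\<^sub>R v))) (at s within {0..1})"
      unfolding \<psi>_def by (intro derivative_intros)
    then show ?thesis
      using lin by (simp add: has_field_derivative_def linear_scale mult_commute_abs)
  qed
  have "\<psi> 0 \<ge> 0"
  proof -
    have "((\<lambda>s. (\<phi> s - \<phi> 0) / (s - 0)) \<longlongrightarrow> \<psi> 0) (at_right 0)"
      using \<phi>'[of 0] unfolding has_field_derivative_iff
      by (simp add: at_within_Icc_at_right)
    moreover have "((\<lambda>s. - e s) \<longlongrightarrow> - 0) (at_right 0)" using e by (intro tendsto_intros)
    moreover have "\<forall>\<^sub>F s in at_right 0. - e s \<le> (\<phi> s - \<phi> 0) / (s - 0)"
    proof -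
      have "- e s \<le> (\<phi> s - \<phi> 0) / (s - 0)" if "0 < s" "s < 1" for s
        using ge[of s] that by (simp add: \<phi>_def z_def v_def field_simps)
      then show ?thesis
        unfolding eventually_at_right_field by (intro exI[of _ 1]) auto
    qed
    ultimately show ?thesis
      using tendsto_le[of "at_right (0::real)"] by force
  qed
  have cont: "continuous_on {0..1} \<phi>"
    by (rule DERIV_continuous_on[OF \<phi>'])
  obtain s1 where s1: "s1 \<in> {0..1}" "\<And>s. s \<in> {0..1} \<Longrightarrow> \<phi> s \<le> \<phi> s1"
    using continuous_attains_sup[OF _ _ cont] by auto
  \<comment> \<open>Room to the right of the maximum is essential. A maximum at the end
    \<open>1\<close> can be exchanged for one at \<open>0\<close>, because
    \<open>f y \<le> f x\<close>.\<close>
  obtain s0 where s0: "0 \<le> s0" "s0 < 1" "\<And>s. s \<in> {0..1} \<Longrightarrow> \<phi> s \<le> \<phi> s0"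
  proof (cases "s1 = 1")
    case True
    have "\<phi> 1 \<le> \<phi> 0" using fyx by (simp add: \<phi>_def z_def v_def)
    with True s1 that[of 0] show ?thesis by fastforce
  next
    case False
    with s1 that[of s1] show ?thesis by auto
  qed
  have le0: "\<psi> s0 \<le> 0"
  proof (rule ccontr)
    assume "\<not> ?thesis"
    then obtain d where d: "d > 0" "\<And>h. h > 0 \<Longrightarrow> s0 + h \<in> {0..1} \<Longrightarrow> h < d \<Longrightarrow> \<phi> s0 < \<phi> (s0 + h)"
      using has_real_derivative_pos_inc_right[OF \<phi>'[of s0]] s0 by auto
    define h where "h = min (d/2) (1 - s0)"
    have "\<phi> s0 < \<phi> (s0 + h)" using d s0 by (intro d(2)) (auto simp: h_def)
    moreover have "\<phi> (s0 + h) \<le> \<phi> s0" using d s0 by (intro s0(3)) (auto simp: h_def)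
    ultimately show False by simp
  qed
  have "\<psi> s0 = 0"
  proof (rule ccontr)
    assume "\<psi> s0 \<noteq> 0"
    then have neg: "\<psi> s0 < 0" using le0 by simp
    with \<open>\<psi> 0 \<ge> 0\<close> have "s0 > 0" using s0 by (cases "s0 = 0") auto
    obtain d where d: "d > 0" "\<And>h. h > 0 \<Longrightarrow> s0 - h \<in> {0..1} \<Longrightarrow> h < d \<Longrightarrow> \<phi> s0 < \<phi> (s0 - h)"
      using has_real_derivative_neg_dec_left[OF \<phi>'[of s0] neg] s0 by auto
    define h where "h = min (d/2) s0"
    have "\<phi> s0 < \<phi> (s0 - h)" using d s0 \<open>s0 > 0\<close> by (intro d(2)) (auto simp: h_def)
    moreover have "\<phi> (s0 - h) \<le> \<phi> s0" using d s0 \<open>s0 > 0\<close> by (intro s0(3)) (auto simp: h_def)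
    ultimately show False by simp
  qed
  \<comment> \<open>The slope \<open>\<psi>\<close> is zero at \<open>s0\<close> with positive
    derivative, hence positive just to the right; by the mean value theorem \<open>\<phi>\<close>
    then exceeds its maximum.\<close>
  then have "0 < v \<bullet> H (z s0) v" using pos[OF zS v] s0 by (simp add: \<psi>_def)
  then obtain d where d: "d > 0" "\<And>h. h > 0 \<Longrightarrow> s0 + h \<in> {0..1} \<Longrightarrow> h < d \<Longrightarrow> 0 < \<psi> (s0 + h)"
    using has_real_derivative_pos_inc_right[OF \<psi>'[of s0]] s0 \<open>\<psi> s0 = 0\<close> by auto
  define h where "h = min (d/2) (1 - s0)"
  have h: "0 < h" "s0 + h \<le> 1" "h < d" using d s0 by (auto simp: h_def)
  have "\<exists>\<xi>. s0 < \<xi> \<and> \<xi> < s0 + h \<and> \<phi> (s0 + h) - \<phi> s0 = \<psi> \<xi> * (s0 + h - s0)"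
  proof -
    have "\<exists>\<xi>\<in>{s0<..<s0 + h}. \<phi> (s0 + h) - \<phi> s0 = (\<lambda>t. \<psi> \<xi> * t) (s0 + h - s0)"
    proof (rule mvt_simple)
      show "s0 < s0 + h" using h by simp
      fix s assume "s0 \<le> s" "s \<le> s0 + h"
      then show "(\<phi> has_derivative (*) (\<psi> s)) (at s within {s0..s0 + h})"
        using \<phi>'[of s] h s0 unfolding has_field_derivative_def
        by (auto elim!: has_derivative_subset)
    qed
    then show ?thesis by auto
  qed
  then obtain \<xi> where \<xi>: "s0 < \<xi>" "\<xi> < s0 + h" "\<phi> (s0 + h) - \<phi> s0 = \<psi> \<xi> * h" by auto
  have "0 < \<psi> \<xi>" using d(2)[of "\<xi> - s0"] \<xi> h s0 by auto
  then have "\<phi> (s0 + h) > \<phi> s0" using \<xi> h by (metis diff_gt_0_iff_gt mult_pos_pos)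
  moreover have "\<phi> (s0 + h) \<le> \<phi> s0" using h s0 by (intro s0(3)) auto
  ultimately show False by simp
qed

text \<open>Read \<open>f p \<le> 0\<close> for all \<open>f\<close> as a system of conditions on
  \<open>p\<close>. A limit of points that satisfy the system up to errors tending to 0 satisfies it
  exactly; so if it has no solution, it has none up to some fixed error either. The family may be
  infinite, which allows one condition for every competing policy.\<close>

lemma compact_uniformly_positive:
  fixes K :: "'x::metric_space set" and \<F> :: "('x \<Rightarrow> real) set"
  assumes K: "compact K" and cont: "\<And>f. f \<in> \<F> \<Longrightarrow> continuous_on K f"
    and pos: "\<And>p. p \<in> K \<Longrightarrow> \<exists>f\<in>\<F>. 0 < f p"
  obtains \<kappa> where "\<kappa> > 0" "\<And>p. p \<in> K \<Longrightarrow> \<exists>f\<in>\<F>. \<kappa> < f p"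
proof -
  have "\<exists>\<kappa>>0. \<forall>p\<in>K. \<exists>f\<in>\<F>. \<kappa> < f p"
  proof (rule ccontr)
    assume "\<not> ?thesis"
    then have "\<forall>n. \<exists>p\<in>K. \<forall>f\<in>\<F>. f p \<le> 1 / real (Suc n)"
      by (metis not_le of_nat_0_less_iff zero_less_Suc zero_less_divide_1_iff)
    then obtain p where p: "\<And>n. p n \<in> K" "\<And>n f. f \<in> \<F> \<Longrightarrow> f (p n) \<le> 1 / real (Suc n)" by metis
    obtain l r where l: "l \<in> K" and r: "strict_mono r" "(p \<circ> r) \<longlonglongrightarrow> l"
      using K p(1) unfolding compact_def by blast
    have "f l \<le> 0" if f: "f \<in> \<F>" for f
    proof -
      have "(\<lambda>n. f ((p \<circ> r) n)) \<longlonglongrightarrow> f l"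
        using continuous_on_tendsto_compose[OF cont[OF f] r(2) l] p(1) by simp
      moreover have "(\<lambda>n. 1 / real (Suc (r n))) \<longlonglongrightarrow> 0"
        using LIMSEQ_subseq_LIMSEQ[OF LIMSEQ_inverse_real_of_nat r(1)] by (simp add: o_def inverse_eq_divide)
      ultimately show ?thesis
        using p(2)[OF f] by (intro LIMSEQ_le) (auto intro!: exI[of _ 0])
    qed
    then show False using pos[OF l] by fastforce
  qed
  then show ?thesis using that by blast
qed

subsection \<open>The estimates along typical sequences of states\<close>

text \<open>
  \<open>X\<close> is the range of the vectors \<open>h (q)\<close> rather than of the parameters \<open>q\<close>: in these coordinates
  both mean values are convex.
\<close>

locale policy_objective =
  fixes X :: "'v::euclidean_space set" and N :: "'v \<Rightarrow> real" and D :: "'c::finite \<Rightarrow> 'v \<Rightarrow> real"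
    and p :: "'c \<Rightarrow> real"
begin

definition S :: "('v ^ 'c) set" where "S = {x. \<forall>c. x $ c \<in> X}"

definition F :: "'v ^ 'c \<Rightarrow> real" where "F x = (\<Sum>c\<in>UNIV. p c * N (x $ c))"

definition G :: "'v ^ 'c \<Rightarrow> real" where "G x = (\<Sum>c\<in>UNIV. p c * D c (x $ c))"

end

text \<open>Kept apart from \<open>policy_objective\<close> because the continuity of
  \<open>D\<close> is itself derived by means of \<open>S\<close>, \<open>F\<close> and
  \<open>G\<close>. The interval \<open>{l..B}\<close> is also to contain both estimates;
  \<open>1 \<le> B\<close> allows errors of order \<open>B\<close> to be absorbed in those of order
  \<open>B\<^sup>2\<close>.\<close>

locale policy_space = policy_objective X N D p
  for X :: "'v::euclidean_space set" and N and D :: "'c::finite \<Rightarrow> 'v \<Rightarrow> real" and p +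
  fixes l B :: real
  assumes compact_X: "compact X" and convex_X: "convex X" and X_nonempty: "X \<noteq> {}"
    and convex_N: "convex_on X N" and convex_D: "\<And>c. convex_on X (D c)"
    and cont_N: "continuous_on X N" and cont_D: "\<And>c. continuous_on X (D c)"
    and N_bounds: "\<And>x. x \<in> X \<Longrightarrow> N x \<in> {l..B}" and D_bounds: "\<And>c x. x \<in> X \<Longrightarrow> D c x \<in> {l..B}"
    and l_pos: "0 < l" and B_ge_1: "1 \<le> B"
    and p_nonneg: "\<And>c. 0 \<le> p c" and p_sum: "(\<Sum>c\<in>UNIV. p c) = 1"
begin

lemma compact_S: "compact S"
proof -
  have "S = (\<Inter>c. (\<lambda>x. x $ c) -` X)" by (auto simp: S_def)
  moreover have "closed ((\<lambda>x :: 'v ^ 'c. x $ c) -` X)" for c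
    using compact_X by (intro closed_vimage compact_imp_closed continuous_intros)
  ultimately have "closed S" by (simp add: closed_INT)
  moreover have "bounded S"
  proof -
    obtain b where b: "\<And>x. x \<in> X \<Longrightarrow> norm x \<le> b"
      using compact_imp_bounded[OF compact_X] by (auto simp: bounded_iff)
    have "norm x \<le> (\<Sum>c\<in>(UNIV::'c set). b)" if "x \<in> S" for x
    proof -
      have "norm x \<le> (\<Sum>c\<in>UNIV. norm (x $ c))"
        unfolding norm_vec_def by (rule L2_set_le_sum) simp
      also have "\<dots> \<le> (\<Sum>c\<in>(UNIV::'c set). b)" using that b by (intro sum_mono) (auto simp: S_def)
      finally show ?thesis .
    qed
    then show ?thesis by (auto simp: bounded_iff)
  qed
  ultimately show ?thesis by (simp add: compact_eq_bounded_closed)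
qed

lemma continuous_on_F: "continuous_on S F"
  unfolding F_def
  by (intro continuous_intros continuous_on_compose2[OF cont_N]) (auto simp: S_def)

lemma continuous_on_G: "continuous_on S G"
  unfolding G_def
  by (intro continuous_intros continuous_on_compose2[OF cont_D]) (auto simp: S_def)

lemma weighted_sum_bounds:
  assumes "\<And>c. f c \<in> {l..B}" shows "(\<Sum>c\<in>UNIV. p c * f c) \<in> {l..B}"
proof -
  have "(\<Sum>c\<in>UNIV. p c * l) \<le> (\<Sum>c\<in>UNIV. p c * f c)"
    using assms p_nonneg by (intro sum_mono mult_left_mono) auto
  moreover have "(\<Sum>c\<in>UNIV. p c * f c) \<le> (\<Sum>c\<in>UNIV. p c * B)"
    using assms p_nonneg by (intro sum_mono mult_left_mono) auto
  ultimately show ?thesis by (simp add: p_sum flip: sum_distrib_right)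
qed

lemma F_bounds: "x \<in> S \<Longrightarrow> F x \<in> {l..B}"
  unfolding F_def by (rule weighted_sum_bounds) (use N_bounds in \<open>auto simp: S_def\<close>)

lemma G_bounds: "x \<in> S \<Longrightarrow> G x \<in> {l..B}"
  unfolding G_def by (rule weighted_sum_bounds) (use D_bounds in \<open>auto simp: S_def\<close>)

lemma convex_comb:
  assumes "x \<in> S" "y \<in> S" "0 \<le> t" "t \<le> 1"
  defines "z \<equiv> (1 - t) *\<^sub>R x + t *\<^sub>R y"
  shows "z \<in> S" "F z \<le> (1 - t) * F x + t * F y" "G z \<le> (1 - t) * G x + t * G y"
proof -
  have z: "z $ c = (1 - t) *\<^sub>R (x $ c) + t *\<^sub>R (y $ c)" for c by (simp add: z_def)
  show "z \<in> S" using assms(1-4) convex_X by (auto simp: S_def z convex_alt)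
  have le: "(\<Sum>c\<in>UNIV. p c * f c (z $ c)) \<le>
      (1 - t) * (\<Sum>c\<in>UNIV. p c * f c (x $ c)) + t * (\<Sum>c\<in>UNIV. p c * f c (y $ c))"
    if f: "\<And>c. convex_on X (f c)" for f
  proof -
    have "p c * f c (z $ c) \<le> p c * ((1 - t) * f c (x $ c) + t * f c (y $ c))" for c
      using assms(1-4) p_nonneg[of c]
      by (auto simp: S_def z intro!: mult_left_mono convex_onD[OF f])
    then have "(\<Sum>c\<in>UNIV. p c * f c (z $ c)) \<le>
      (\<Sum>c\<in>UNIV. p c * ((1 - t) * f c (x $ c) + t * f c (y $ c)))" by (rule sum_mono)
    also have "\<dots> = (1 - t) * (\<Sum>c\<in>UNIV. p c * f c (x $ c)) + t * (\<Sum>c\<in>UNIV. p c * f c (y $ c))"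
      by (simp add: sum_distrib_left sum.distrib sum_subtractf algebra_simps)
    finally show ?thesis .
  qed
  show "F z \<le> (1 - t) * F x + t * F y" unfolding F_def by (rule le[OF convex_N])
  show "G z \<le> (1 - t) * G x + t * G y" unfolding G_def by (rule le[OF convex_D])
qed

text \<open>The round number is written \<open>Suc n\<close>, so that \<open>c 0\<close> and
  \<open>x 0\<close> never occur.\<close>

definition nac_run :: "real \<Rightarrow> (nat \<Rightarrow> 'c) \<Rightarrow> (nat \<Rightarrow> 'v) \<Rightarrow> (nat \<Rightarrow> real) \<Rightarrow> (nat \<Rightarrow> real) \<Rightarrow> bool" where
  "nac_run \<beta> c x u v \<longleftrightarrow> u 0 \<in> {l..B} \<and> v 0 \<in> {l..B} \<and>
     (\<forall>n. x (Suc n) \<in> X \<and>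
        u (Suc n) = (1 - \<beta>) * u n + \<beta> * N (x (Suc n)) \<and>
        v (Suc n) = (1 - \<beta>) * v n + \<beta> * D (c (Suc n)) (x (Suc n)) \<and>
        (\<forall>y\<in>X. u n * D (c (Suc n)) (x (Suc n)) + v n * N (x (Suc n))
               \<le> u n * D (c (Suc n)) y + v n * N y))"

text \<open>A step adds \<open>\<beta> * (a n - w n)\<close>, where both terms lie in
  \<open>{l..B}\<close>. Freezing \<open>w\<close> at its value at the start of \<open>k\<close>
  rounds changes each increment by at most \<open>\<beta> * (k * \<beta> * B)\<close>, hence the
  total only to second order in \<open>k * \<beta>\<close>.\<close>

lemma average_change:
  assumes \<beta>: "0 \<le> \<beta>" "\<beta> \<le> 1" and w: "w 0 \<in> {l..B}" "\<And>n. a n \<in> {l..B}"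
    and rec: "\<And>n. w (Suc n) = (1 - \<beta>) * w n + \<beta> * a n"
  shows "w n \<in> {l..B}"
    and "\<bar>w (s + j) - w s\<bar> \<le> real j * \<beta> * B"
    and "\<bar>w (s + k) - (w s + \<beta> * (\<Sum>j<k. a (s + j) - w s))\<bar> \<le> B * (real k * \<beta>)\<^sup>2"
proof -
  show b: "w n \<in> {l..B}" for n
  proof (induction n)
    case (Suc n)
    have "(1 - \<beta>) * l + \<beta> * l \<le> w (Suc n)" "w (Suc n) \<le> (1 - \<beta>) * B + \<beta> * B"
      unfolding rec using \<beta> Suc w(2)[of n] by (auto intro!: add_mono mult_left_mono)
    then show ?case by (simp add: algebra_simps)
  qed (use w in auto)
  show ch: "\<bar>w (s + j) - w s\<bar> \<le> real j * \<beta> * B" for j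
  proof (induction j)
    case (Suc j)
    have "\<bar>w (s + Suc j) - w (s + j)\<bar> = \<beta> * \<bar>a (s + j) - w (s + j)\<bar>"
    proof -
      have "w (s + Suc j) - w (s + j) = \<beta> * (a (s + j) - w (s + j))"
        by (simp add: rec algebra_simps)
      then show ?thesis using \<beta> by (simp add: abs_mult)
    qed
    also have "\<dots> \<le> \<beta> * B"
      using \<beta> b[of "s + j"] w(2)[of "s + j"] l_pos by (intro mult_left_mono) auto
    finally show ?case using Suc by (simp add: algebra_simps)
  qed simp
  have sum: "w (s + k) = w s + \<beta> * (\<Sum>j<k. a (s + j) - w (s + j))"
    by (induction k) (simp_all add: rec algebra_simps)
  have "\<bar>\<Sum>j<k. w (s + j) - w s\<bar> \<le> (\<Sum>j<k. \<bar>w (s + j) - w s\<bar>)" by (rule sum_abs)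
  also have "\<dots> \<le> (\<Sum>j<k. real k * \<beta> * B)"
  proof (rule sum_mono)
    fix j assume "j \<in> {..<k}"
    then have "real j * \<beta> * B \<le> real k * \<beta> * B"
      using \<beta> B_ge_1 by (intro mult_right_mono) auto
    then show "\<bar>w (s + j) - w s\<bar> \<le> real k * \<beta> * B" using ch[of j] by linarith
  qed
  finally have "\<beta> * \<bar>\<Sum>j<k. w (s + j) - w s\<bar> \<le> \<beta> * (real k * (real k * \<beta> * B))"
    using \<beta> by (intro mult_left_mono) auto
  moreover have "w (s + k) - (w s + \<beta> * (\<Sum>j<k. a (s + j) - w s)) =
      - (\<beta> * (\<Sum>j<k. w (s + j) - w s))"
    unfolding sum by (simp add: sum_subtractf algebra_simps)
  ultimately show "\<bar>w (s + k) - (w s + \<beta> * (\<Sum>j<k. a (s + j) - w s))\<bar> \<le> B * (real k * \<beta>)\<^sup>2"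
    using \<beta> by (simp add: abs_mult power2_eq_square mult_ac)
qed

end

section \<open>One block of rounds\<close>

text \<open>The block consists of the \<open>k\<close> rounds after \<open>s\<close>, and
  \<open>\<theta> = k * \<beta>\<close> acts as its step size: up to second order the estimates move
  the fraction \<open>\<theta>\<close> of the way to the block averages \<open>wu\<close> and
  \<open>wv\<close>. In the bound on \<open>\<zeta>\<close>, half of \<open>8 * B\<^sup>2\<close>
  pays for the drift of the weights during the block and half for terms quadratic in
  \<open>\<theta>\<close>; the summand with \<open>\<eta>\<close> pays for inexact state
  frequencies.\<close>

locale nac_block = policy_space X N D p l B
  for X :: "'v::euclidean_space set" and N and D :: "'c::finite \<Rightarrow> 'v \<Rightarrow> real" and p l B +
  fixes \<beta> :: real and c :: "nat \<Rightarrow> 'c" and x :: "nat \<Rightarrow> 'v" and u v :: "nat \<Rightarrow> real"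
    and s k :: nat and \<eta> \<zeta> :: real
  assumes run: "nac_run \<beta> c x u v" and \<beta>: "0 < \<beta>" "\<beta> < 1"
    and k: "0 < k" "real k * \<beta> \<le> 1"
    and freq: "\<And>a. \<bar>real (card {j. j < k \<and> c (Suc (s + j)) = a}) - real k * p a\<bar> \<le> \<eta> * real k"
    and \<zeta>: "8 * B\<^sup>2 * (real k * \<beta>) + 2 * real CARD('c) * B\<^sup>2 * \<eta> \<le> \<zeta>"
begin

abbreviation "\<theta> \<equiv> real k * \<beta>"

definition "wu = (\<Sum>j<k. N (x (Suc (s + j)))) / real k"
definition "wv = (\<Sum>j<k. D (c (Suc (s + j))) (x (Suc (s + j)))) / real k"

lemma x_in: "x (Suc n) \<in> X"
  and opt: "y \<in> X \<Longrightarrow> u n * D (c (Suc n)) (x (Suc n)) + v n * N (x (Suc n))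
               \<le> u n * D (c (Suc n)) y + v n * N y"
  using run by (auto simp: nac_run_def)

lemmas u_change = average_change[of \<beta> u "\<lambda>n. N (x (Suc n))"]
lemmas v_change = average_change[of \<beta> v "\<lambda>n. D (c (Suc n)) (x (Suc n))"]

lemma u_facts: "u n \<in> {l..B}" "\<bar>u (s + j) - u s\<bar> \<le> real j * \<beta> * B"
    "\<bar>u (s + k) - ((1 - \<theta>) * u s + \<theta> * wu)\<bar> \<le> B * \<theta>\<^sup>2"
proof -
  show "u n \<in> {l..B}" "\<bar>u (s + j) - u s\<bar> \<le> real j * \<beta> * B"
    by (rule u_change; use run \<beta> N_bounds in \<open>auto simp: nac_run_def\<close>)+
  have "\<bar>u (s + k) - (u s + \<beta> * (\<Sum>j<k. N (x (Suc (s + j))) - u s))\<bar> \<le> B * \<theta>\<^sup>2"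
    by (rule u_change; use run \<beta> N_bounds in \<open>auto simp: nac_run_def\<close>)
  then show "\<bar>u (s + k) - ((1 - \<theta>) * u s + \<theta> * wu)\<bar> \<le> B * \<theta>\<^sup>2"
    using k by (simp add: wu_def sum_subtractf algebra_simps)
qed

lemma v_facts: "v n \<in> {l..B}" "\<bar>v (s + j) - v s\<bar> \<le> real j * \<beta> * B"
    "\<bar>v (s + k) - ((1 - \<theta>) * v s + \<theta> * wv)\<bar> \<le> B * \<theta>\<^sup>2"
proof -
  show "v n \<in> {l..B}" "\<bar>v (s + j) - v s\<bar> \<le> real j * \<beta> * B"
    by (rule v_change; use run \<beta> D_bounds in \<open>auto simp: nac_run_def\<close>)+
  have "\<bar>v (s + k) - (v s + \<beta> * (\<Sum>j<k. D (c (Suc (s + j))) (x (Suc (s + j))) - v s))\<bar> \<le> B * \<theta>\<^sup>2"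
    by (rule v_change; use run \<beta> D_bounds in \<open>auto simp: nac_run_def\<close>)
  then show "\<bar>v (s + k) - ((1 - \<theta>) * v s + \<theta> * wv)\<bar> \<le> B * \<theta>\<^sup>2"
    using k by (simp add: wv_def sum_subtractf algebra_simps)
qed

lemma \<eta>_nonneg: "0 \<le> \<eta>"
  using order_trans[OF abs_ge_zero freq[of undefined]] k by (simp add: zero_le_mult_iff)

text \<open>Choices made in rounds with the same state are averaged into one value of a policy. By
  convexity this does not increase the mean values, and replacing empirical frequencies by
  \<open>p\<close> costs at most \<open>\<eta> * B\<close> for each state.\<close>

lemma averages_almost_achievable:
  "\<exists>y\<in>S. F y \<le> wu + real CARD('c) * \<eta> * B \<and> G y \<le> wv + real CARD('c) * \<eta> * B"
proof -
  define A where "A a = {j. j < k \<and> c (Suc (s + j)) = a}" for a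
  define X' where "X' j = x (Suc (s + j))" for j
  obtain x0 where x0: "x0 \<in> X" using X_nonempty by blast
  \<comment> \<open>The value \<open>x0\<close> at a state that the block never visits is harmless:
    such a state has weight at most \<open>\<eta>\<close>.\<close>
  define y where
    "y = (\<chi> a. if A a = {} then x0 else (\<Sum>j\<in>A a. (1 / real (card (A a))) *\<^sub>R X' j))"
  have fin: "finite (A a)" for a by (simp add: A_def)
  have yX: "y $ a \<in> X" for a
    using x0 fin convex_X x_in
    by (auto simp: y_def X'_def intro!: convex_sum)
  have *: "(\<Sum>a\<in>UNIV. p a * f a (y $ a)) \<le>
      (\<Sum>j<k. f (c (Suc (s + j))) (X' j)) / real k + real CARD('c) * \<eta> * B"
    if f: "\<And>a. convex_on X (f a)" "\<And>a x. x \<in> X \<Longrightarrow> f a x \<in> {l..B}" for f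
  proof -
    have "real k * (p a * f a (y $ a)) \<le> (\<Sum>j\<in>A a. f (c (Suc (s + j))) (X' j)) + \<eta> * real k * B" for a
    proof -
      have fy: "0 \<le> f a (y $ a)" "f a (y $ a) \<le> B" using f(2)[OF yX, of a a] l_pos by auto
      have "real (card (A a)) * f a (y $ a) \<le> (\<Sum>j\<in>A a. f (c (Suc (s + j))) (X' j))"
      proof (cases "A a = {}")
        case False
        have "f a (\<Sum>j\<in>A a. (1 / real (card (A a))) *\<^sub>R X' j) \<le>
            (\<Sum>j\<in>A a. (1 / real (card (A a))) * f a (X' j))"
          using False fin x_in by (intro convex_on_sum[OF _ _ f(1)]) (auto simp: X'_def)
        also have "\<dots> = (\<Sum>j\<in>A a. f a (X' j)) / real (card (A a))"
          by (simp add: sum_divide_distrib)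
        finally have "real (card (A a)) * f a (y $ a) \<le> (\<Sum>j\<in>A a. f a (X' j))"
          using False fin by (simp add: y_def field_simps card_gt_0_iff)
        also have "\<dots> = (\<Sum>j\<in>A a. f (c (Suc (s + j))) (X' j))"
          by (intro sum.cong) (auto simp: A_def)
        finally show ?thesis .
      qed simp
      moreover have "real k * p a \<le> real (card (A a)) + \<eta> * real k"
        using freq[of a] by (simp add: A_def abs_le_iff)
      then have "(real k * p a) * f a (y $ a) \<le> (real (card (A a)) + \<eta> * real k) * f a (y $ a)"
        using fy by (intro mult_right_mono)
      moreover have "\<eta> * real k * f a (y $ a) \<le> \<eta> * real k * B"
        using fy \<eta>_nonneg by (intro mult_left_mono) auto
      ultimately show ?thesis by (simp add: algebra_simps)
    qed
    then have "(\<Sum>a\<in>UNIV. real k * (p a * f a (y $ a))) \<le>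
        (\<Sum>a\<in>UNIV. (\<Sum>j\<in>A a. f (c (Suc (s + j))) (X' j)) + \<eta> * real k * B)"
      by (rule sum_mono)
    also have "\<dots> = (\<Sum>j<k. f (c (Suc (s + j))) (X' j)) + real CARD('c) * (\<eta> * real k * B)"
      using sum.group[of "{..<k}" UNIV "\<lambda>j. c (Suc (s + j))" "\<lambda>j. f (c (Suc (s + j))) (X' j)"]
      by (simp add: sum.distrib A_def)
    finally show ?thesis using k
      by (simp add: field_simps flip: sum_distrib_left)
  qed
  have "F y \<le> wu + real CARD('c) * \<eta> * B"
    using *[of "\<lambda>_. N"] convex_N N_bounds by (simp add: F_def wu_def X'_def)
  moreover have "G y \<le> wv + real CARD('c) * \<eta> * B"
    using *[of D] convex_D D_bounds by (simp add: G_def wv_def X'_def)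
  moreover have "y \<in> S" using yX by (simp add: S_def)
  ultimately show ?thesis by blast
qed

text \<open>Each round is optimal for its current weights, which differ from those at
  \<open>s\<close> by at most \<open>\<theta> * B\<close>. Exchanging them in the four products of
  the comparison costs \<open>4 * B\<^sup>2 * \<theta>\<close>. The comparison is made state by
  state, so the rounds of the block can then be grouped by state and their frequencies replaced by
  \<open>p\<close>.\<close>

lemma averages_almost_optimal:
  assumes "y \<in> S"
  shows "v s * wu + u s * wv \<le>
    v s * F y + u s * G y + 4 * B\<^sup>2 * \<theta> + 2 * real CARD('c) * B\<^sup>2 * \<eta>"
proof -
  define A where "A a = {j. j < k \<and> c (Suc (s + j)) = a}" for a
  define L where "L a z = u s * D a z + v s * N z" for a z
  have yX: "y $ a \<in> X" for a using assms by (simp add: S_def)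
  have L: "0 \<le> L a (y $ a)" "L a (y $ a) \<le> 2 * B\<^sup>2" for a
  proof -
    have "u s * D a (y $ a) \<le> B * B" "v s * N (y $ a) \<le> B * B"
      using u_facts(1)[of s] v_facts(1)[of s] N_bounds[OF yX[of a]] D_bounds[OF yX[of a], of a] l_pos
      by (auto intro!: mult_mono)
    then show "L a (y $ a) \<le> 2 * B\<^sup>2" by (simp add: L_def power2_eq_square)
    show "0 \<le> L a (y $ a)"
      using u_facts(1)[of s] v_facts(1)[of s] N_bounds[OF yX[of a]] D_bounds[OF yX[of a], of a] l_pos
      by (auto simp: L_def intro!: add_nonneg_nonneg mult_nonneg_nonneg)
  qed
  have step: "L (c (Suc (s + j))) (x (Suc (s + j))) \<le>
      L (c (Suc (s + j))) (y $ (c (Suc (s + j)))) + 4 * B\<^sup>2 * \<theta>" if "j < k" for j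
  proof -
    define a where "a = c (Suc (s + j))"
    define z where "z = x (Suc (s + j))"
    have jk: "real j * \<beta> * B \<le> \<theta> * B"
      using that \<beta> B_ge_1 by (intro mult_right_mono) auto
    have du: "\<bar>u (s + j) - u s\<bar> \<le> \<theta> * B" and dv: "\<bar>v (s + j) - v s\<bar> \<le> \<theta> * B"
      using u_facts(2)[of j] v_facts(2)[of j] jk by linarith+
    have bd: "\<bar>e * w\<bar> \<le> \<theta> * B * B" if "\<bar>e\<bar> \<le> \<theta> * B" "w \<in> {l..B}" for e w
      unfolding abs_mult using that l_pos B_ge_1 \<beta> by (intro mult_mono) auto
    have z: "z \<in> X" using x_in by (simp add: z_def)
    have "u (s + j) * D a z + v (s + j) * N z \<le> u (s + j) * D a (y $ a) + v (s + j) * N (y $ a)"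
      unfolding a_def z_def by (rule opt[OF yX])
    moreover have "\<bar>(u (s + j) - u s) * D a z\<bar> \<le> \<theta> * B * B"
      "\<bar>(v (s + j) - v s) * N z\<bar> \<le> \<theta> * B * B"
      "\<bar>(u (s + j) - u s) * D a (y $ a)\<bar> \<le> \<theta> * B * B"
      "\<bar>(v (s + j) - v s) * N (y $ a)\<bar> \<le> \<theta> * B * B"
      using du dv N_bounds[OF z] N_bounds[OF yX[of a]] D_bounds[OF z, of a] D_bounds[OF yX[of a], of a]
      by (auto intro!: bd)
    ultimately have "L a z \<le> L a (y $ a) + 4 * (\<theta> * B * B)"
      unfolding L_def left_diff_distrib abs_le_iff by linarith
    then show ?thesis by (simp add: a_def z_def power2_eq_square mult_ac)
  qed
  have "real k * (v s * wu + u s * wv) = (\<Sum>j<k. L (c (Suc (s + j))) (x (Suc (s + j))))"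
    using k by (simp add: L_def wu_def wv_def sum.distrib distrib_left flip: sum_distrib_left)
  also have "\<dots> \<le> (\<Sum>j<k. L (c (Suc (s + j))) (y $ (c (Suc (s + j)))) + 4 * B\<^sup>2 * \<theta>)"
    using step by (intro sum_mono) auto
  also have "\<dots> = (\<Sum>j<k. L (c (Suc (s + j))) (y $ (c (Suc (s + j))))) + real k * (4 * B\<^sup>2 * \<theta>)"
    by (simp add: sum.distrib)
  also have "(\<Sum>j<k. L (c (Suc (s + j))) (y $ (c (Suc (s + j))))) =
      (\<Sum>a\<in>UNIV. \<Sum>j\<in>A a. L (c (Suc (s + j))) (y $ (c (Suc (s + j)))))"
    using sum.group[of "{..<k}" UNIV "\<lambda>j. c (Suc (s + j))"
        "\<lambda>j. L (c (Suc (s + j))) (y $ (c (Suc (s + j))))"]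
    by (simp add: A_def)
  also have "\<dots> = (\<Sum>a\<in>UNIV. real (card (A a)) * L a (y $ a))"
  proof (rule sum.cong[OF refl])
    fix a
    have "(\<Sum>j\<in>A a. L (c (Suc (s + j))) (y $ (c (Suc (s + j))))) = (\<Sum>j\<in>A a. L a (y $ a))"
      by (intro sum.cong) (auto simp: A_def)
    then show "(\<Sum>j\<in>A a. L (c (Suc (s + j))) (y $ (c (Suc (s + j))))) =
        real (card (A a)) * L a (y $ a)" by simp
  qed
  also have "\<dots> \<le> (\<Sum>a\<in>UNIV. real k * (p a * L a (y $ a)) + real k * (2 * B\<^sup>2 * \<eta>))"
  proof (rule sum_mono)
    fix a
    have "real (card (A a)) \<le> real k * p a + \<eta> * real k"
      using freq[of a] by (simp add: A_def abs_le_iff)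
    then have "real (card (A a)) * L a (y $ a) \<le> (real k * p a + \<eta> * real k) * L a (y $ a)"
      using L by (intro mult_right_mono)
    moreover have "\<eta> * real k * L a (y $ a) \<le> \<eta> * real k * (2 * B\<^sup>2)"
      using L \<eta>_nonneg by (intro mult_left_mono) auto
    ultimately show "real (card (A a)) * L a (y $ a) \<le>
        real k * (p a * L a (y $ a)) + real k * (2 * B\<^sup>2 * \<eta>)"
      by (simp add: algebra_simps)
  qed
  also have "\<dots> = real k * (v s * F y + u s * G y + 2 * real CARD('c) * B\<^sup>2 * \<eta>)"
    by (simp add: L_def F_def G_def sum.distrib sum_distrib_left algebra_simps)
  finally have "real k * (v s * wu + u s * wv) \<le>
      real k * (v s * F y + u s * G y + 4 * B\<^sup>2 * \<theta> + 2 * real CARD('c) * B\<^sup>2 * \<eta>)"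
    by (simp add: algebra_simps)
  then show ?thesis using k by simp
qed

lemma \<theta>: "0 < \<theta>" "\<theta> \<le> 1" using k \<beta> by auto

text \<open>
  \<open>e\<close> bounds the distance of the estimates from the upper image of \<open>(F, G)\<close>; it contracts to \<open>\<zeta>\<close>.
\<close>

lemma excess_step:
  assumes "\<exists>y\<in>S. F y \<le> u s + e \<and> G y \<le> v s + e"
  shows "\<exists>y\<in>S. F y \<le> u (s + k) + ((1 - \<theta>) * e + \<theta> * \<zeta>) \<and>
           G y \<le> v (s + k) + ((1 - \<theta>) * e + \<theta> * \<zeta>)"
proof -
  obtain y1 where y1: "y1 \<in> S" "F y1 \<le> u s + e" "G y1 \<le> v s + e" using assms by blast
  obtain y2 where y2: "y2 \<in> S" "F y2 \<le> wu + real CARD('c) * \<eta> * B"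
    "G y2 \<le> wv + real CARD('c) * \<eta> * B" using averages_almost_achievable by blast
  \<comment> \<open>The two witnesses are mixed with the weights with which the estimates move from
    their old values to the block averages; by convexity \<open>F\<close> and \<open>G\<close>
    follow.\<close>
  define y where "y = (1 - \<theta>) *\<^sub>R y1 + \<theta> *\<^sub>R y2"
  have y: "y \<in> S" "F y \<le> (1 - \<theta>) * F y1 + \<theta> * F y2" "G y \<le> (1 - \<theta>) * G y1 + \<theta> * G y2"
    unfolding y_def using convex_comb[OF y1(1) y2(1)] \<theta> by auto
  \<comment> \<open>\<open>\<zeta>\<close> is dimensioned for the change of the product, in units of
    \<open>B\<^sup>2\<close>; the errors here are of order \<open>B\<close>.\<close>
  have BB: "B \<le> B\<^sup>2" using B_ge_1 by (simp add: power2_eq_square)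
  have "B * \<theta> \<le> 8 * B\<^sup>2 * \<theta>" using BB \<theta> B_ge_1 by (intro mult_right_mono) auto
  moreover have "real CARD('c) * \<eta> * B \<le> real CARD('c) * \<eta> * B\<^sup>2"
    using BB \<eta>_nonneg by (intro mult_left_mono) auto
  moreover have "0 \<le> real CARD('c) * \<eta> * B\<^sup>2" using \<eta>_nonneg by simp
  ultimately have "real CARD('c) * \<eta> * B + B * \<theta> \<le> \<zeta>" using \<zeta> by (simp add: mult_ac)
  then have z: "\<theta> * (real CARD('c) * \<eta> * B + B * \<theta>) \<le> \<theta> * \<zeta>" using \<theta> by (intro mult_left_mono) auto
  have "F y \<le> (1 - \<theta>) * (u s + e) + \<theta> * (wu + real CARD('c) * \<eta> * B)"
    using y(2) y1(2) y2(2) \<theta> mult_left_mono[OF y1(2), of "1 - \<theta>"] mult_left_mono[OF y2(2), of \<theta>]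
    by linarith
  then have 1: "F y \<le> u (s + k) + ((1 - \<theta>) * e + \<theta> * \<zeta>)"
    using u_facts(3) z by (simp add: algebra_simps power2_eq_square abs_le_iff)
  have "G y \<le> (1 - \<theta>) * (v s + e) + \<theta> * (wv + real CARD('c) * \<eta> * B)"
    using y(3) y1(3) y2(3) \<theta> mult_left_mono[OF y1(3), of "1 - \<theta>"] mult_left_mono[OF y2(3), of \<theta>]
    by linarith
  then have 2: "G y \<le> v (s + k) + ((1 - \<theta>) * e + \<theta> * \<zeta>)"
    using v_facts(3) z by (simp add: algebra_simps power2_eq_square abs_le_iff)
  show ?thesis using y(1) 1 2 by blast
qed

text \<open>Expanding the product of the two moved estimates leaves the change of the linearization
  towards \<open>(wu, wv)\<close>, multiplied by \<open>\<theta>\<close>, and terms of order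
  \<open>\<theta>\<^sup>2\<close>. Near optimality of the averages then allows any policy
  \<open>y\<close> in their place.\<close>

lemma product_step:
  assumes "y \<in> S"
  shows "u (s + k) * v (s + k) \<le> u s * v s + \<theta> * (v s * F y + u s * G y - 2 * u s * v s) + \<theta> * \<zeta>"
proof -
  define a where "a = (1 - \<theta>) * u s + \<theta> * wu"
  define b where "b = (1 - \<theta>) * v s + \<theta> * wv"
  have avg: "(\<Sum>j<k. f j) / real k \<in> {0..B}" if "\<And>j. f j \<in> {l..B}" for f
  proof -
    have "0 \<le> (\<Sum>j<k. f j)" using that l_pos by (intro sum_nonneg) (simp add: order_trans[of 0 l])
    moreover have "(\<Sum>j<k. f j) \<le> (\<Sum>j<k. B)" using that by (intro sum_mono) auto
    ultimately show ?thesis using k by (simp add: field_simps)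
  qed
  have w: "wu \<in> {0..B}" "wv \<in> {0..B}"
    unfolding wu_def wv_def by (intro avg N_bounds D_bounds x_in)+
  have us: "0 \<le> u n" "u n \<le> B" "0 \<le> v n" "v n \<le> B" for n
    using u_facts(1)[of n] v_facts(1)[of n] l_pos by auto
  have a: "0 \<le> a" "a \<le> B"
  proof -
    show "0 \<le> a" using w us \<theta> by (auto simp: a_def)
    have "a \<le> (1 - \<theta>) * B + \<theta> * B" unfolding a_def using w us \<theta>
      by (intro add_mono mult_left_mono) auto
    then show "a \<le> B" by (simp add: algebra_simps)
  qed
  have bd: "\<bar>e * w\<bar> \<le> B * \<theta>\<^sup>2 * B" if "\<bar>e\<bar> \<le> B * \<theta>\<^sup>2" "0 \<le> w" "w \<le> B" for e w
    unfolding abs_mult using that B_ge_1 by (intro mult_mono) auto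
  have "\<bar>(u (s + k) - a) * v (s + k)\<bar> \<le> B * \<theta>\<^sup>2 * B" "\<bar>(v (s + k) - b) * a\<bar> \<le> B * \<theta>\<^sup>2 * B"
    using u_facts(3) v_facts(3) us a by (auto simp: a_def b_def intro!: bd)
  then have "u (s + k) * v (s + k) \<le> a * b + 2 * (B * \<theta>\<^sup>2 * B)"
    unfolding abs_le_iff by (simp add: algebra_simps)
  also have "a * b = u s * v s + \<theta> * (v s * wu + u s * wv - 2 * u s * v s) +
      \<theta>\<^sup>2 * (u s * v s - v s * wu - u s * wv + wu * wv)"
    by (simp add: a_def b_def algebra_simps power2_eq_square)
  also have "\<theta>\<^sup>2 * (u s * v s - v s * wu - u s * wv + wu * wv) \<le> \<theta>\<^sup>2 * (2 * (B * B))"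
  proof -
    have "u s * v s \<le> B * B" "wu * wv \<le> B * B" using us w B_ge_1 by (auto intro!: mult_mono)
    moreover have "0 \<le> v s * wu" "0 \<le> u s * wv" using us w by auto
    ultimately show ?thesis by (intro mult_left_mono) auto
  qed
  finally have "u (s + k) * v (s + k) \<le> u s * v s + \<theta> * (v s * wu + u s * wv - 2 * u s * v s)
      + \<theta> * (4 * B\<^sup>2 * \<theta>)" by (simp add: power2_eq_square algebra_simps)
  also have "\<theta> * (v s * wu + u s * wv - 2 * u s * v s) \<le>
      \<theta> * (v s * F y + u s * G y + 4 * B\<^sup>2 * \<theta> + 2 * real CARD('c) * B\<^sup>2 * \<eta> - 2 * u s * v s)"
    using averages_almost_optimal[OF assms] \<theta> by (intro mult_left_mono) auto
  finally have "u (s + k) * v (s + k) \<le> u s * v s + \<theta> * (v s * F y + u s * G y - 2 * u s * v s)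
      + \<theta> * (8 * B\<^sup>2 * \<theta> + 2 * real CARD('c) * B\<^sup>2 * \<eta>)" by (simp add: algebra_simps)
  also have "\<theta> * (8 * B\<^sup>2 * \<theta> + 2 * real CARD('c) * B\<^sup>2 * \<eta>) \<le> \<theta> * \<zeta>"
    using \<zeta> \<theta> by (intro mult_left_mono) auto
  finally show ?thesis by simp
qed

end

section \<open>Descent to the optimum\<close>

text \<open>The premise of \<open>stationary\<close> says that \<open>x\<close> minimizes the
  linearization of the product at its own values, so that estimates equal to
  \<open>(F x, G x)\<close> would not be improved. Only the pair of values needs to be determined,
  since the estimates carry no further information about the policy.\<close>

locale unique_optimum = policy_space X N D p l B
  for X :: "'v::euclidean_space set" and N and D :: "'c::finite \<Rightarrow> 'v \<Rightarrow> real" and p l B +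
  fixes us vs :: real
  assumes stationary: "\<And>x. x \<in> S \<Longrightarrow>
      (\<And>y. y \<in> S \<Longrightarrow> 2 * F x * G x \<le> G x * F y + F x * G y) \<Longrightarrow> F x = us \<and> G x = vs"
    and minimal: "\<And>x. x \<in> S \<Longrightarrow> us * vs \<le> F x * G x"
    and minimal_unique: "\<And>x. x \<in> S \<Longrightarrow> F x * G x = us * vs \<Longrightarrow> F x = us \<and> G x = vs"
begin

text \<open>Estimates in the upper image at which no policy lowers the linearization must be the
  values of a stationary policy, hence optimal; this contradicts a product that exceeds the optimum
  by \<open>\<epsilon>\<close>. Compactness turns the contradiction into a gap
  \<open>\<kappa>\<close> that tolerates an excess of the same size.\<close>

lemma descent_direction:
  assumes "0 < \<epsilon>"
  obtains \<kappa> where "0 < \<kappa>"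
    "\<And>x u v. x \<in> S \<Longrightarrow> u \<in> {l..B} \<Longrightarrow> v \<in> {l..B} \<Longrightarrow> F x \<le> u + \<kappa> \<Longrightarrow> G x \<le> v + \<kappa> \<Longrightarrow>
       us * vs + \<epsilon> \<le> u * v \<Longrightarrow> \<exists>y\<in>S. v * F y + u * G y \<le> 2 * u * v - \<kappa>"
proof -
  define K where "K = S \<times> {l..B} \<times> {l..B}"
  define \<F> where "\<F> = {\<lambda>(x, u, v). F x - u, \<lambda>(x, u, v). G x - v, \<lambda>(x, u, v). us * vs + \<epsilon> - u * v} \<union>
     (\<lambda>y (x :: 'v ^ 'c, u, v). 2 * u * v - (v * F y + u * G y)) ` S"
  have K: "compact K" unfolding K_def by (intro compact_Times compact_S compact_Icc)
  have cont: "continuous_on K f" if "f \<in> \<F>" for f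
    using that unfolding \<F>_def K_def
    by (auto simp: split_beta intro!: continuous_intros continuous_on_compose2[OF continuous_on_F]
        continuous_on_compose2[OF continuous_on_G])
  have pos: "\<exists>f\<in>\<F>. 0 < f q" if "q \<in> K" for q
  proof (rule ccontr)
    assume neg: "\<not> ?thesis"
    obtain x u v where q: "q = (x, u, v)" by (cases q)
    have x: "x \<in> S" and u: "0 < u" and v: "0 < v" using that l_pos by (auto simp: K_def q)
    from neg have n: "F x \<le> u" "G x \<le> v" "us * vs + \<epsilon> \<le> u * v"
      "\<And>y. y \<in> S \<Longrightarrow> 2 * u * v \<le> v * F y + u * G y"
      by (auto simp: \<F>_def q not_less)
    \<comment> \<open>Testing with \<open>y = x\<close> forces both nonnegative gaps to vanish, so
      the linearization is the one at \<open>(F x, G x)\<close> itself.\<close>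
    have "0 \<le> v * (u - F x)" "0 \<le> u * (v - G x)" using n(1,2) u v by auto
    moreover have "v * (u - F x) + u * (v - G x) \<le> 0" using n(4)[OF x] by (simp add: algebra_simps)
    ultimately have "v * (u - F x) = 0" "u * (v - G x) = 0" by linarith+
    then have eq: "F x = u" "G x = v" using u v by auto
    have "F x = us \<and> G x = vs" using n(4) by (intro stationary[OF x]) (auto simp: eq)
    then show False using eq n(3) assms by simp
  qed
  obtain \<kappa> where \<kappa>: "0 < \<kappa>" "\<And>q. q \<in> K \<Longrightarrow> \<exists>f\<in>\<F>. \<kappa> < f q"
    using compact_uniformly_positive[OF K cont pos] by blast
  show ?thesis
  proof (rule that[OF \<kappa>(1)])
    fix x u v
    assume a: "x \<in> S" "u \<in> {l..B}" "v \<in> {l..B}" "F x \<le> u + \<kappa>" "G x \<le> v + \<kappa>"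
      "us * vs + \<epsilon> \<le> u * v"
    then obtain f where "f \<in> \<F>" "\<kappa> < f (x, u, v)" using \<kappa>(2)[of "(x, u, v)"] by (auto simp: K_def)
    then show "\<exists>y\<in>S. v * F y + u * G y \<le> 2 * u * v - \<kappa>"
      using a \<kappa>(1) by (force simp: \<F>_def)
  qed
qed

text \<open>In the limiting case \<open>F x * G x \<le> u * G x \<le> u * v \<le> us * vs \<le> F x
  * G x\<close>, and all are equalities: the level curve of the product meets the upper image only
  at the optimum. Compactness makes this quantitative.\<close>

lemma near_optimum:
  assumes "0 < \<rho>"
  obtains \<kappa> where "0 < \<kappa>"
    "\<And>x u v. x \<in> S \<Longrightarrow> u \<in> {l..B} \<Longrightarrow> v \<in> {l..B} \<Longrightarrow> F x \<le> u + \<kappa> \<Longrightarrow> G x \<le> v + \<kappa> \<Longrightarrow>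
       u * v \<le> us * vs + \<kappa> \<Longrightarrow> norm (u - us, v - vs) < \<rho>"
proof -
  define K where "K = S \<times> {l..B} \<times> {l..B}"
  define \<F> :: "(('v ^ 'c) \<times> real \<times> real \<Rightarrow> real) set" where
    "\<F> = {\<lambda>(x, u, v). F x - u, \<lambda>(x, u, v). G x - v, \<lambda>(x, u, v). u * v - us * vs,
       \<lambda>(x, u, v). \<rho> - norm (u - us, v - vs)}"
  have K: "compact K" unfolding K_def by (intro compact_Times compact_S compact_Icc)
  have cont: "continuous_on K f" if "f \<in> \<F>" for f
    using that unfolding \<F>_def K_def
    by (auto simp: split_beta intro!: continuous_intros continuous_on_compose2[OF continuous_on_F]
        continuous_on_compose2[OF continuous_on_G])
  have pos: "\<exists>f\<in>\<F>. 0 < f q" if "q \<in> K" for q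
  proof (rule ccontr)
    assume neg: "\<not> ?thesis"
    obtain x u v where q: "q = (x, u, v)" by (cases q)
    have x: "x \<in> S" and u: "0 < u" and v: "0 < v" using that l_pos by (auto simp: K_def q)
    have FG: "0 < F x" "0 < G x" using F_bounds[OF x] G_bounds[OF x] l_pos by auto
    from neg have n: "F x \<le> u" "G x \<le> v" "u * v \<le> us * vs" "\<rho> \<le> norm (u - us, v - vs)"
      by (auto simp: \<F>_def q not_less)
    have le: "F x * G x \<le> u * G x" "u * G x \<le> u * v" using n u FG by auto
    with minimal[OF x] n(3) have "F x * G x = us * vs" by linarith
    moreover from le minimal[OF x] n(3) have "F x * G x = u * G x" "u * G x = u * v" by linarith+
    then have "F x = u" "G x = v" using u FG by auto
    ultimately have "u = us" "v = vs" using minimal_unique[OF x] by auto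
    then show False using n(4) assms by simp
  qed
  obtain \<kappa> where \<kappa>: "0 < \<kappa>" "\<And>q. q \<in> K \<Longrightarrow> \<exists>f\<in>\<F>. \<kappa> < f q"
    using compact_uniformly_positive[OF K cont pos] by blast
  show ?thesis
  proof (rule that[OF \<kappa>(1)])
    fix x u v
    assume a: "x \<in> S" "u \<in> {l..B}" "v \<in> {l..B}" "F x \<le> u + \<kappa>" "G x \<le> v + \<kappa>"
      "u * v \<le> us * vs + \<kappa>"
    then obtain f where "f \<in> \<F>" "\<kappa> < f (x, u, v)" using \<kappa>(2)[of "(x, u, v)"] by (auto simp: K_def)
    then show "norm (u - us, v - vs) < \<rho>"
      using a \<kappa>(1) by (force simp: \<F>_def)
  qed
qed

text \<open>The constants are fixed before the step size, the starting round and the run, which is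
  what makes the later probability bound uniform. A range for \<open>k * \<beta>\<close> is allowed
  because \<open>k\<close> is an integer.\<close>

theorem estimates_converge:
  assumes "0 < \<rho>"
  shows "\<exists>\<delta> \<eta> J. 0 < \<delta> \<and> \<delta> \<le> 1 \<and> 0 < \<eta> \<and>
    (\<forall>\<beta> k s c x u v. nac_run \<beta> c x u v \<longrightarrow> 0 < \<beta> \<longrightarrow> \<beta> < 1 \<longrightarrow>
       \<delta> / 2 \<le> real k * \<beta> \<longrightarrow> real k * \<beta> \<le> \<delta> \<longrightarrow>
       (\<forall>i<J. \<forall>a. \<bar>real (card {j. j < k \<and> c (Suc (s + i * k + j)) = a}) - real k * p a\<bar>
          \<le> \<eta> * real k) \<longrightarrow>
       norm (u (s + J * k) - us, v (s + J * k) - vs) < \<rho>)"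
proof -
  obtain \<kappa>B where \<kappa>B: "0 < \<kappa>B"
    "\<And>x u v. x \<in> S \<Longrightarrow> u \<in> {l..B} \<Longrightarrow> v \<in> {l..B} \<Longrightarrow> F x \<le> u + \<kappa>B \<Longrightarrow> G x \<le> v + \<kappa>B \<Longrightarrow>
       u * v \<le> us * vs + \<kappa>B \<Longrightarrow> norm (u - us, v - vs) < \<rho>"
    using near_optimum[OF assms] by metis
  have "0 < \<kappa>B / 2" using \<kappa>B by simp
  then obtain \<kappa>A where \<kappa>A: "0 < \<kappa>A"
    "\<And>x u v. x \<in> S \<Longrightarrow> u \<in> {l..B} \<Longrightarrow> v \<in> {l..B} \<Longrightarrow> F x \<le> u + \<kappa>A \<Longrightarrow> G x \<le> v + \<kappa>A \<Longrightarrow>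
       us * vs + \<kappa>B / 2 \<le> u * v \<Longrightarrow> \<exists>y\<in>S. v * F y + u * G y \<le> 2 * u * v - \<kappa>A"
    using descent_direction by metis
  \<comment> \<open>The excess will settle below \<open>2 * \<zeta>\<close>, within the tolerance of
    both compactness lemmas, and the error \<open>\<zeta>\<close> consumes at most half of the
    descent \<open>\<kappa>A\<close>.\<close>
  define \<zeta> where "\<zeta> = min \<kappa>A \<kappa>B / 2"
  have \<zeta>: "0 < \<zeta>" "\<zeta> \<le> \<kappa>A / 2" "\<zeta> \<le> \<kappa>B / 2" using \<kappa>A \<kappa>B by (auto simp: \<zeta>_def)
  define m where "m = real CARD('c)"
  have m: "1 \<le> m" by (simp add: m_def Suc_leI)
  have BB: "1 \<le> B\<^sup>2" using B_ge_1 by simp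
  \<comment> \<open>The second entry reserves half of \<open>\<zeta>\<close> for the errors in
    \<open>\<theta>\<close>; the third keeps the growth of the product in one block below
    \<open>\<kappa>B / 2\<close>.\<close>
  define \<delta> where "\<delta> = min 1 (min (\<zeta> / (16 * B\<^sup>2)) (\<kappa>B / (2 * (2 * B\<^sup>2 + \<zeta>))))"
  have "0 < B\<^sup>2" using BB by linarith
  then have \<delta>: "0 < \<delta>" "\<delta> \<le> 1"
    using \<zeta> \<kappa>B(1) by (auto simp: \<delta>_def intro!: divide_pos_pos add_pos_pos mult_pos_pos)
  have \<delta>1: "8 * B\<^sup>2 * \<delta> \<le> \<zeta> / 2"
  proof -
    have "\<delta> \<le> \<zeta> / (16 * B\<^sup>2)" by (simp add: \<delta>_def)
    then show ?thesis using \<open>0 < B\<^sup>2\<close> by (simp add: field_simps)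
  qed
  have \<delta>2: "\<delta> * (2 * B\<^sup>2 + \<zeta>) \<le> \<kappa>B / 2"
  proof -
    have "\<delta> \<le> \<kappa>B / (2 * (2 * B\<^sup>2 + \<zeta>))" by (simp add: \<delta>_def)
    moreover have "0 < 2 * B\<^sup>2 + \<zeta>" using BB \<zeta> by linarith
    ultimately show ?thesis by (simp add: field_simps)
  qed
  \<comment> \<open>The other half of \<open>\<zeta>\<close> is spent on the frequencies.\<close>
  define \<eta> where "\<eta> = \<zeta> / (4 * m * B\<^sup>2)"
  have \<eta>: "0 < \<eta>" "2 * m * B\<^sup>2 * \<eta> = \<zeta> / 2" using \<zeta> m \<open>0 < B\<^sup>2\<close> by (auto simp: \<eta>_def field_simps)
  \<comment> \<open>Each block contracts the excess beyond \<open>\<zeta>\<close> by at least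
    \<open>1 - \<delta> / 2\<close>, starting from at most \<open>B\<close>.\<close>
  obtain J1 where J1: "(1 - \<delta> / 2) ^ J1 < \<zeta> / B"
    using real_arch_pow_inv[of "\<zeta> / B" "1 - \<delta> / 2"] \<zeta> \<delta> B_ge_1 by auto
  \<comment> \<open>A block of descent gains at least \<open>\<delta> / 2 * (\<kappa>A / 2)\<close>,
    and the product never exceeds \<open>B\<^sup>2\<close>.\<close>
  have "0 < \<delta> / 2 * (\<kappa>A / 2)" using \<delta> \<kappa>A(1) by simp
  from reals_Archimedean3[OF this]
  obtain J2 where J2: "B\<^sup>2 < real J2 * (\<delta> / 2 * (\<kappa>A / 2))" by blast
  define J where "J = J1 + J2"
  show ?thesis
  proof (rule exI[of _ \<delta>], rule exI[of _ \<eta>], rule exI[of _ J], intro conjI \<delta> \<eta>(1) allI impI)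
    fix \<beta> :: real and k s :: nat and c x u v
    assume run: "nac_run \<beta> c x u v" and \<beta>: "0 < \<beta>" "\<beta> < 1"
      and k\<beta>: "\<delta> / 2 \<le> real k * \<beta>" "real k * \<beta> \<le> \<delta>"
      and freq': "\<forall>i<J. \<forall>a.
          \<bar>real (card {j. j < k \<and> c (Suc (s + i * k + j)) = a}) - real k * p a\<bar> \<le> \<eta> * real k"
    have freq: "\<bar>real (card {j. j < k \<and> c (Suc (s + i * k + j)) = a}) - real k * p a\<bar> \<le> \<eta> * real k"
      if "i < J" for i a using freq' that by simp
    define \<theta> where "\<theta> = real k * \<beta>"
    have \<theta>: "\<delta> / 2 \<le> \<theta>" "\<theta> \<le> \<delta>" "0 < \<theta>" "\<theta> \<le> 1" using k\<beta> \<delta> by (auto simp: \<theta>_def)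
    then have k: "0 < k" by (cases k) (auto simp: \<theta>_def)
    have block: "nac_block X N D p l B \<beta> c x u v (s + i * k) k \<eta> \<zeta>" if "i < J" for i
    proof unfold_locales
      have "8 * B\<^sup>2 * \<theta> \<le> 8 * B\<^sup>2 * \<delta>" using \<theta> by (intro mult_left_mono) auto
      then show "8 * B\<^sup>2 * (real k * \<beta>) + 2 * real CARD('c) * B\<^sup>2 * \<eta> \<le> \<zeta>"
        using \<delta>1 \<eta> by (simp add: \<theta>_def m_def)
      show "real k * \<beta> \<le> 1" using \<theta> by (simp add: \<theta>_def)
    qed (use run \<beta> k freq[OF that] in auto)
    have uv: "u n \<in> {l..B}" "v n \<in> {l..B}" for n
      using average_change(1)[of \<beta> u "\<lambda>n. N (x (Suc n))" n] average_change(1)[of \<beta> v "\<lambda>n. D (c (Suc n)) (x (Suc n))" n]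
        run \<beta> N_bounds D_bounds by (auto simp: nac_run_def)
    define U where "U i = u (s + i * k)" for i
    define V where "V i = v (s + i * k)" for i
    have UV: "U i \<in> {l..B}" "V i \<in> {l..B}" for i using uv by (auto simp: U_def V_def)
    have excess_step: "\<exists>y\<in>S. F y \<le> U (Suc i) + ((1 - \<theta>) * e + \<theta> * \<zeta>) \<and>
        G y \<le> V (Suc i) + ((1 - \<theta>) * e + \<theta> * \<zeta>)"
      if "i < J" "\<exists>y\<in>S. F y \<le> U i + e \<and> G y \<le> V i + e" for i e
      using nac_block.excess_step[OF block[OF that(1)], of e] that(2)
      by (simp add: U_def V_def \<theta>_def algebra_simps)
    have product_step: "U (Suc i) * V (Suc i) \<le>
        U i * V i + \<theta> * (V i * F y + U i * G y - 2 * U i * V i) + \<theta> * \<zeta>" if "i < J" "y \<in> S" for i y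
      using nac_block.product_step[OF block[OF that(1)] that(2)]
      by (simp add: U_def V_def \<theta>_def algebra_simps)
    have excess: "\<exists>y\<in>S. F y \<le> U i + (\<zeta> + (1 - \<theta>) ^ i * B) \<and> G y \<le> V i + (\<zeta> + (1 - \<theta>) ^ i * B)"
      if "i \<le> J" for i
      using that
    proof (induction i)
      case 0
      obtain x0 where "x0 \<in> X" using X_nonempty by blast
      then have y: "(\<chi> c. x0) \<in> S" by (simp add: S_def)
      have "F (\<chi> c. x0) \<le> U 0 + (\<zeta> + B)" "G (\<chi> c. x0) \<le> V 0 + (\<zeta> + B)"
        using F_bounds[OF y] G_bounds[OF y] UV[of 0] \<zeta> l_pos by auto
      then show ?case using y by auto
    next
      case (Suc i)
      have "(1 - \<theta>) * (\<zeta> + (1 - \<theta>) ^ i * B) + \<theta> * \<zeta> = \<zeta> + (1 - \<theta>) ^ Suc i * B"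
        by (simp add: algebra_simps)
      then show ?case using excess_step[OF _ Suc.IH] Suc.prems by simp
    qed
    have late: "\<exists>y\<in>S. F y \<le> U i + 2 * \<zeta> \<and> G y \<le> V i + 2 * \<zeta>" if "J1 \<le> i" "i \<le> J" for i
    proof -
      have "(1 - \<theta>) ^ i \<le> (1 - \<theta>) ^ J1" using that \<theta> by (intro power_decreasing) auto
      also have "\<dots> \<le> (1 - \<delta> / 2) ^ J1" using \<theta> by (intro power_mono) auto
      finally have "(1 - \<theta>) ^ i \<le> \<zeta> / B" using J1 by simp
      then have "(1 - \<theta>) ^ i * B \<le> \<zeta>" using B_ge_1 by (simp add: field_simps)
      moreover obtain y where "y \<in> S" "F y \<le> U i + (\<zeta> + (1 - \<theta>) ^ i * B)"
        "G y \<le> V i + (\<zeta> + (1 - \<theta>) ^ i * B)" using excess[OF \<open>i \<le> J\<close>] by blast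
      ultimately show ?thesis by (intro bexI[of _ y]) auto
    qed
    \<comment> \<open>From above the level \<open>us * vs + \<kappa>B / 2\<close> a block descends;
      from below it, a block cannot climb past \<open>us * vs + \<kappa>B\<close>. The maximum
      records both alternatives.\<close>
    have product: "U (J1 + i) * V (J1 + i) \<le> max (B\<^sup>2 - real i * (\<theta> * (\<kappa>A / 2))) (us * vs + \<kappa>B)"
      if "i \<le> J2" for i
      using that
    proof (induction i)
      case 0
      have "U J1 * V J1 \<le> B * B" using UV[of J1] l_pos by (intro mult_mono) auto
      then show ?case by (simp add: power2_eq_square)
    next
      case (Suc i)
      define a where "a = J1 + i"
      have a: "J1 \<le> a" "a < J" "a \<le> J" using Suc.prems by (auto simp: a_def J_def)
      obtain y where y: "y \<in> S" "F y \<le> U a + 2 * \<zeta>" "G y \<le> V a + 2 * \<zeta>" using late a by blast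
      show ?case
      proof (cases "us * vs + \<kappa>B / 2 \<le> U a * V a")
        case True
        then obtain z where z: "z \<in> S" "V a * F z + U a * G z \<le> 2 * U a * V a - \<kappa>A"
          using \<kappa>A(2)[OF y(1) UV[of a]] y \<zeta> by auto
        have "\<theta> * (V a * F z + U a * G z - 2 * U a * V a) \<le> \<theta> * (- \<kappa>A)"
          using z \<theta> by (intro mult_left_mono) auto
        moreover have "\<theta> * \<zeta> \<le> \<theta> * (\<kappa>A / 2)" using \<zeta> \<theta> by (intro mult_left_mono) auto
        ultimately have "U (Suc a) * V (Suc a) \<le> U a * V a - \<theta> * (\<kappa>A / 2)"
          using product_step[OF a(2) z(1)] by (simp add: algebra_simps)
        moreover have "0 < \<theta> * (\<kappa>A / 2)" using \<theta> \<kappa>A by simp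
        moreover have "real (Suc i) * (\<theta> * (\<kappa>A / 2)) = real i * (\<theta> * (\<kappa>A / 2)) + \<theta> * (\<kappa>A / 2)"
          by (simp add: algebra_simps)
        moreover have "U a * V a \<le> max (B\<^sup>2 - real i * (\<theta> * (\<kappa>A / 2))) (us * vs + \<kappa>B)"
          using Suc by (simp add: a_def)
        ultimately have "U (Suc a) * V (Suc a) \<le>
            max (B\<^sup>2 - real (Suc i) * (\<theta> * (\<kappa>A / 2))) (us * vs + \<kappa>B)" by linarith
        then show ?thesis by (simp add: a_def)
      next
        case False
        \<comment> \<open>Only a crude upper bound on the change is needed, so any policy serves for
          comparison.\<close>
        have "V a * F y \<le> B * B" "U a * G y \<le> B * B"
          using UV[of a] F_bounds[OF y(1)] G_bounds[OF y(1)] l_pos by (auto intro!: mult_mono)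
        moreover have "0 \<le> U a * V a" using UV[of a] l_pos by auto
        ultimately have "\<theta> * (V a * F y + U a * G y - 2 * U a * V a) \<le> \<theta> * (2 * B\<^sup>2)"
          using \<theta> by (intro mult_left_mono) (auto simp: power2_eq_square)
        moreover have "\<theta> * (2 * B\<^sup>2 + \<zeta>) \<le> \<delta> * (2 * B\<^sup>2 + \<zeta>)" using \<theta> \<zeta> by (intro mult_right_mono) auto
        ultimately have "U (Suc a) * V (Suc a) \<le> us * vs + \<kappa>B"
          using product_step[OF a(2) y(1)] \<delta>2 False by (simp add: algebra_simps)
        then show ?thesis by (simp add: a_def)
      qed
    qed
    \<comment> \<open>After \<open>J2\<close> blocks the first entry of the maximum is not positive,
      whereas the product is, so the bound is the second entry.\<close>
    have "B\<^sup>2 \<le> real J2 * (\<theta> * (\<kappa>A / 2))"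
    proof -
      have "real J2 * (\<delta> / 2 * (\<kappa>A / 2)) \<le> real J2 * (\<theta> * (\<kappa>A / 2))"
        using \<theta> \<kappa>A by (intro mult_left_mono mult_right_mono) auto
      then show ?thesis using J2 by linarith
    qed
    moreover have "0 < U J * V J" using UV[of J] l_pos by auto
    ultimately have "U J * V J \<le> us * vs + \<kappa>B"
      using product[of J2] by (auto simp: J_def max_def split: if_splits)
    moreover obtain y where "y \<in> S" "F y \<le> U J + 2 * \<zeta>" "G y \<le> V J + 2 * \<zeta>"
      using late[of J] by (auto simp: J_def)
    ultimately have "norm (U J - us, V J - vs) < \<rho>"
      using UV[of J] \<zeta> by (intro \<kappa>B(2)[of y]) auto
    then show "norm (u (s + J * k) - us, v (s + J * k) - vs) < \<rho>" by (simp add: U_def V_def)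
  qed
qed

end

subsection \<open>A weak law of large numbers for finite Markov chains\<close>

text \<open>By invariance the support of \<open>\<mu>\<close> is closed under transitions, and every
  state can be reached from it.\<close>

lemma irreducible_support:
  assumes irr: "irreducible_kernel K" and inv: "bind_pmf \<mu> K = \<mu>"
  shows "0 < pmf \<mu> y"
proof -
  obtain x where x: "x \<in> set_pmf \<mu>" using set_pmf_not_empty[of \<mu>] by blast
  have "set_pmf (kernel_power K n x) \<subseteq> set_pmf \<mu>" for n
  proof (induction n)
    case (Suc n)
    have "(\<Union>z\<in>set_pmf \<mu>. set_pmf (K z)) = set_pmf \<mu>"
      by (subst (2) inv[symmetric]) (simp only: set_bind_pmf)
    with Suc show ?case by (auto simp: kernel_power_def)
  qed (use x in \<open>simp add: kernel_power_def\<close>)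
  then show ?thesis
    using irr unfolding irreducible_kernel_def by (metis pmf_positive_iff subsetD)
qed

lemma sum_pmf_UNIV: "(\<Sum>b\<in>UNIV. pmf (q :: 'c::finite pmf) b) = 1"
  by (rule sum_pmf_eq_1) auto

text \<open>Maximum principle: at a maximum the average over successors can equal the value only if
  all successors are maxima too, and irreducibility carries this to every state.\<close>

lemma harmonic_constant:
  fixes K :: "'c::finite \<Rightarrow> 'c pmf" and g :: "'c \<Rightarrow> real"
  assumes irr: "irreducible_kernel K" and harm: "\<And>x. g x = (\<Sum>b\<in>UNIV. pmf (K x) b * g b)"
  shows "g x = g y"
proof -
  obtain z where z: "\<And>y. g y \<le> g z"
    using Max_in[of "range g"] Max_ge[of "range g"] by (metis finite finite_imageI empty_not_UNIV image_is_empty imageE rangeI)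
  have step: "g b = g z" if "g w = g z" "b \<in> set_pmf (K w)" for w b
  proof -
    have "(\<Sum>b\<in>UNIV. pmf (K w) b * (g z - g b)) = 0"
      using harm[of w] that(1) by (simp add: right_diff_distrib sum_subtractf sum_pmf_UNIV flip: sum_distrib_right)
    then have "pmf (K w) b * (g z - g b) = 0"
      using z by (subst (asm) sum_nonneg_eq_0_iff) (auto simp del: mult_eq_0_iff)
    then show ?thesis using that(2) by (simp add: set_pmf_iff)
  qed
  have "\<forall>b\<in>set_pmf (kernel_power K n z). g b = g z" for n
    by (induction n) (auto simp: kernel_power_def intro: step)
  then have "g b = g z" for b
    using irr unfolding irreducible_kernel_def by (metis pmf_positive_iff)
  then show ?thesis by metis
qed

text \<open>Adding the mean of \<open>g\<close> to \<open>g - P g\<close> makes the operator injective, hence onto.\<close>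

lemma poisson_equation:
  fixes K :: "'c::finite \<Rightarrow> 'c pmf" and f :: "'c \<Rightarrow> real"
  assumes irr: "irreducible_kernel K" and inv: "bind_pmf \<mu> K = \<mu>"
    and mean: "(\<Sum>a\<in>UNIV. pmf \<mu> a * f a) = 0"
  shows "\<exists>g. \<forall>x. f x = g x - (\<Sum>b\<in>UNIV. pmf (K x) b * g b)"
proof -
  define P :: "real ^ 'c \<Rightarrow> 'c \<Rightarrow> real" where "P g x = (\<Sum>b\<in>UNIV. pmf (K x) b * g $ b)" for g x
  define m :: "real ^ 'c \<Rightarrow> real" where "m g = (\<Sum>a\<in>UNIV. pmf \<mu> a * g $ a)" for g
  define T :: "real ^ 'c \<Rightarrow> real ^ 'c" where "T g = (\<chi> x. g $ x - P g x + m g)" for g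
  have mP: "(\<Sum>a\<in>UNIV. pmf \<mu> a * P g a) = m g" for g
  proof -
    have "(\<Sum>a\<in>UNIV. pmf \<mu> a * P g a) = (\<Sum>b\<in>UNIV. (\<Sum>a\<in>UNIV. pmf \<mu> a * pmf (K a) b) * g $ b)"
      unfolding P_def sum_distrib_left sum_distrib_right by (subst sum.swap) (simp add: mult_ac)
    also have "\<dots> = (\<Sum>b\<in>UNIV. pmf (bind_pmf \<mu> K) b * g $ b)"
      by (simp add: pmf_bind integral_measure_pmf_real[of UNIV] mult.commute)
    finally show ?thesis by (simp add: inv m_def)
  qed
  \<comment> \<open>Invariance makes \<open>g\<close> and \<open>P g\<close> have the same mean, so
    only the added constant survives.\<close>
  have mT: "(\<Sum>a\<in>UNIV. pmf \<mu> a * T g $ a) = m g" for g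
  proof -
    have "(\<Sum>a\<in>UNIV. pmf \<mu> a * T g $ a) = m g - (\<Sum>a\<in>UNIV. pmf \<mu> a * P g a) + m g"
    proof -
      have "(\<Sum>a\<in>UNIV. pmf \<mu> a * m g) = m g"
        by (simp add: sum_pmf_UNIV flip: sum_distrib_right)
      then show ?thesis
        by (simp add: T_def m_def[of g] right_diff_distrib distrib_left sum.distrib sum_subtractf)
    qed
    then show ?thesis by (simp add: mP)
  qed
  have lin: "linear T"
    by (rule linearI)
      (simp_all add: T_def P_def m_def vec_eq_iff algebra_simps sum.distrib sum_distrib_left)
  have "inj T"
  proof (subst linear_injective_0[OF lin], intro allI impI)
    fix g assume T0: "T g = 0"
    \<comment> \<open>With mean zero, a kernel element is harmonic, hence constant, hence equal to
      its mean.\<close>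
    have m0: "m g = 0" using mT[of g] by (simp add: T0)
    have "g $ x = P g x" for x using T0 by (simp add: T_def m0 vec_eq_iff)
    then have const: "g $ x = g $ y" for x y
      using harmonic_constant[OF irr, of "\<lambda>x. g $ x"] unfolding P_def by blast
    have "m g = g $ x" for x
    proof -
      have "m g = (\<Sum>a\<in>UNIV. pmf \<mu> a * g $ x)" unfolding m_def using const by (intro sum.cong) auto
      then show ?thesis by (simp add: sum_pmf_UNIV flip: sum_distrib_right)
    qed
    then show "g = 0" by (simp add: m0 vec_eq_iff)
  qed
  then have "surj T" using lin linear_injective_imp_surjective by blast
  then obtain g where g: "T g = (\<chi> x. f x)" by (metis surjD)
  \<comment> \<open>The preimage inherits mean zero from \<open>f\<close>, so the correction term
    disappears and the original equation is solved.\<close>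
  have "m g = 0" using mT[of g] mean by (simp add: g)
  then have "f x = g $ x - P g x" for x using arg_cong[OF g, of "\<lambda>v. v $ x"] by (simp add: T_def)
  then show ?thesis by (intro exI[of _ "\<lambda>x. g $ x"]) (simp add: P_def)
qed

section \<open>Visit frequencies by a martingale bound\<close>

locale finite_markov_chain = prob_space M
  for M :: "'w measure" + fixes K :: "'c::finite \<Rightarrow> 'c pmf" and C :: "nat \<Rightarrow> 'w \<Rightarrow> 'c"
  assumes chain: "markov_chain M K C"
begin

lemma C_measurable: "1 \<le> n \<Longrightarrow> C n \<in> measurable M (count_space UNIV)"
  using chain by (simp add: markov_chain_def)

lemma C_borel: "1 \<le> n \<Longrightarrow> (\<lambda>\<omega>. f (C n \<omega>) :: real) \<in> borel_measurable M"
  by (rule measurable_compose[OF C_measurable]) auto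

lemma C_event: "1 \<le> n \<Longrightarrow> {\<omega> \<in> space M. C n \<omega> = a} \<in> events"
  using measurable_sets[OF C_measurable, of n "{a}"] by (simp add: vimage_def Int_def conj_commute)

lemma path_event: "{\<omega> \<in> space M. \<forall>k\<in>{1..n}. C k \<omega> = q k} \<in> events"
proof -
  have "{\<omega> \<in> space M. \<forall>k\<in>{1..n}. C k \<omega> = q k} =
      space M - (\<Union>k\<in>{1..n}. space M - {\<omega> \<in> space M. C k \<omega> = q k})" by auto
  also have "\<dots> \<in> events" by (intro sets.Diff sets.top sets.finite_UN C_event) auto
  finally show ?thesis .
qed

text \<open>The Markov property is conditional and silent about null paths; in product form both
  sides vanish there, so it can be summed over all paths.\<close>

lemma path_prob:
  assumes "1 \<le> n"
  shows "\<P>(\<omega> in M. (\<forall>k\<in>{1..n}. C k \<omega> = q k) \<and> C (Suc n) \<omega> = b) =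
    \<P>(\<omega> in M. \<forall>k\<in>{1..n}. C k \<omega> = q k) * pmf (K (q n)) b"
proof -
  let ?A = "{\<omega> \<in> space M. \<forall>k\<in>{1..n}. C k \<omega> = q k}"
  let ?E = "{\<omega> \<in> space M. (\<forall>k\<in>{1..n}. C k \<omega> = q k) \<and> C (Suc n) \<omega> = b}"
  show ?thesis
  proof (cases "prob ?A > 0")
    case True
    define q' where "q' = q(Suc n := b)"
    have q': "(\<forall>k\<in>{1..n}. C k \<omega> = q' k) \<longleftrightarrow> (\<forall>k\<in>{1..n}. C k \<omega> = q k)" for \<omega>
      by (auto simp: q'_def)
    have "\<P>(\<omega> in M. C (Suc n) \<omega> = q' (Suc n) \<bar> \<forall>k\<in>{1..n}. C k \<omega> = q' k) = pmf (K (q' n)) (q' (Suc n))"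
      using chain[unfolded markov_chain_def, THEN conjunct2, THEN conjunct2, rule_format, of n q'] assms True
      by (simp only: q')
    then show ?thesis
      using True unfolding cond_prob_def q'
      by (simp add: q'_def field_simps conj_commute)
  next
    case False
    then have "prob ?A = 0" by (simp add: zero_less_measure_iff)
    moreover have "prob ?E \<le> prob ?A" by (intro finite_measure_mono path_event) auto
    ultimately show ?thesis by (simp add: measure_le_0_iff)
  qed
qed

text \<open>Orthogonality of a martingale increment to the past, without conditional expectations:
  there are finitely many paths, and for each of them the increments, weighted by the transition
  probabilities, sum to zero.\<close>

lemma martingale_increment:
  assumes n: "1 \<le> n"
    and Y: "\<And>\<omega>. \<omega> \<in> space M \<Longrightarrow> Y \<omega> = \<phi> (restrict (\<lambda>k. C k \<omega>) {1..n})"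
  shows "expectation (\<lambda>\<omega>. Y \<omega> * (g (C (Suc n) \<omega>) - (\<Sum>b\<in>UNIV. pmf (K (C n \<omega>)) b * g b))) = (0::real)"
proof -
  \<comment> \<open>Paths are extensional, so that the one followed by \<open>\<omega>\<close> is a
    single element of the finite set \<open>R\<close>.\<close>
  define R where "R = PiE {1..n} (\<lambda>_. UNIV :: 'c set)"
  define Pg where "Pg a = (\<Sum>b\<in>UNIV. pmf (K a) b * g b)" for a
  define E where "E q b = {\<omega> \<in> space M. (\<forall>k\<in>{1..n}. C k \<omega> = q k) \<and> C (Suc n) \<omega> = b}" for q b
  have fin: "finite R" by (simp add: R_def finite_PiE)
  have E: "E q b \<in> events" for q b
  proof -
    have "E q b = {\<omega> \<in> space M. \<forall>k\<in>{1..n}. C k \<omega> = q k} \<inter> {\<omega> \<in> space M. C (Suc n) \<omega> = b}"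
      by (auto simp: E_def)
    then show ?thesis using path_event C_event by auto
  qed
  have "Y \<omega> * (g (C (Suc n) \<omega>) - Pg (C n \<omega>)) =
      (\<Sum>q\<in>R. \<Sum>b\<in>UNIV. \<phi> q * (g b - Pg (q n)) * indicat_real (E q b) \<omega>)" if \<omega>: "\<omega> \<in> space M" for \<omega>
  proof -
    define p where "p = restrict (\<lambda>k. C k \<omega>) {1..n}"
    have p: "p \<in> R" by (auto simp: p_def R_def)
    have "\<phi> q * (g b - Pg (q n)) * indicat_real (E q b) \<omega> =
        (if q = p then (if b = C (Suc n) \<omega> then \<phi> p * (g b - Pg (p n)) else 0) else 0)"
      if "q \<in> R" for q b
    proof -
      have "q = p \<longleftrightarrow> (\<forall>k\<in>{1..n}. C k \<omega> = q k)"
      proof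
        assume "\<forall>k\<in>{1..n}. C k \<omega> = q k"
        then show "q = p" using that unfolding R_def p_def
          by (intro PiE_ext[of q "{1..n}" "\<lambda>_. UNIV"]) auto
      qed (simp add: p_def)
      then show ?thesis using \<omega> by (auto simp: E_def indicator_def)
    qed
    then have "(\<Sum>q\<in>R. \<Sum>b\<in>UNIV. \<phi> q * (g b - Pg (q n)) * indicat_real (E q b) \<omega>) =
        (\<Sum>q\<in>R. \<Sum>b\<in>UNIV. (if q = p then (if b = C (Suc n) \<omega> then \<phi> p * (g b - Pg (p n)) else 0) else 0))"
      by (intro sum.cong) auto
    also have "\<dots> = (\<Sum>q\<in>R. if q = p then \<phi> p * (g (C (Suc n) \<omega>) - Pg (p n)) else 0)"
      by (intro sum.cong) auto
    also have "\<dots> = \<phi> p * (g (C (Suc n) \<omega>) - Pg (p n))" using fin p by simp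
    finally show ?thesis using n Y[OF \<omega>] by (simp add: p_def)
  qed
  then have "expectation (\<lambda>\<omega>. Y \<omega> * (g (C (Suc n) \<omega>) - Pg (C n \<omega>))) =
      expectation (\<lambda>\<omega>. \<Sum>q\<in>R. \<Sum>b\<in>UNIV. \<phi> q * (g b - Pg (q n)) * indicat_real (E q b) \<omega>)"
    by (intro Bochner_Integration.integral_cong) auto
  also have "\<dots> = (\<Sum>q\<in>R. \<Sum>b\<in>UNIV. \<phi> q * (g b - Pg (q n)) * prob (E q b))"
    using E by (subst Bochner_Integration.integral_sum | simp add: emeasure_eq_measure
        del: sum_mult_indicator sum_indicator_mult)+
  also have "\<dots> = 0"
  proof (rule sum.neutral, rule ballI)
    fix q assume "q \<in> R"
    define A where "A = \<P>(\<omega> in M. \<forall>k\<in>{1..n}. C k \<omega> = q k)"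
    have "(\<Sum>b\<in>UNIV. \<phi> q * (g b - Pg (q n)) * prob (E q b)) =
        (\<Sum>b\<in>UNIV. \<phi> q * A * (pmf (K (q n)) b * g b - Pg (q n) * pmf (K (q n)) b))"
      unfolding E_def path_prob[OF n] by (simp add: A_def algebra_simps)
    also have "\<dots> = \<phi> q * A * (Pg (q n) - Pg (q n) * 1)"
      unfolding sum_distrib_left[symmetric] sum_subtractf by (simp add: Pg_def sum_pmf_UNIV flip: sum_distrib_left)
    finally show "(\<Sum>b\<in>UNIV. \<phi> q * (g b - Pg (q n)) * prob (E q b)) = 0" by simp
  qed
  finally show ?thesis by (simp add: Pg_def)
qed

lemma integrable_bounded:
  assumes "f \<in> borel_measurable M" "\<And>\<omega>. \<bar>f \<omega>\<bar> \<le> (b::real)" shows "integrable M f"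
  using assms by (intro integrable_const_bound[of _ b]) auto

text \<open>The mixed terms vanish by orthogonality, and every increment is bounded by
  \<open>2 * b\<close>.\<close>

lemma martingale_variance:
  fixes g :: "'c \<Rightarrow> real"
  assumes g: "\<And>a. \<bar>g a\<bar> \<le> b"
  defines "W \<equiv> \<lambda>n \<omega>. g (C (Suc n) \<omega>) - (\<Sum>a\<in>UNIV. pmf (K (C n \<omega>)) a * g a)"
  shows "expectation (\<lambda>\<omega>. (\<Sum>j<k. W (Suc (s + j)) \<omega>)\<^sup>2) \<le> 4 * b\<^sup>2 * real k"
proof (induction k)
  case (Suc k)
  have Pg: "\<bar>\<Sum>a\<in>UNIV. pmf (K x) a * g a\<bar> \<le> b" for x
  proof -
    have "\<bar>\<Sum>a\<in>UNIV. pmf (K x) a * g a\<bar> \<le> (\<Sum>a\<in>UNIV. pmf (K x) a * b)"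
      using g by (intro order_trans[OF sum_abs] sum_mono) (simp add: abs_mult mult_left_mono)
    then show ?thesis by (simp add: sum_pmf_UNIV flip: sum_distrib_right)
  qed
  have Wb: "\<bar>W n \<omega>\<bar> \<le> 2 * b" for n \<omega>
    unfolding W_def using g[of "C (Suc n) \<omega>"] Pg[of "C n \<omega>"] by linarith
  have Wm: "W n \<in> borel_measurable M" if "1 \<le> n" for n
    unfolding W_def using that by (intro borel_measurable_diff C_borel) auto
  define Y where "Y \<omega> = (\<Sum>j<k. W (Suc (s + j)) \<omega>)" for \<omega>
  define V where "V = W (Suc (s + k))"
  have Ym: "Y \<in> borel_measurable M" unfolding Y_def by (intro borel_measurable_sum Wm) auto
  have Vm: "V \<in> borel_measurable M" unfolding V_def by (intro Wm) auto
  have Yb: "\<bar>Y \<omega>\<bar> \<le> real k * (2 * b)" for \<omega>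
  proof -
    have "\<bar>Y \<omega>\<bar> \<le> (\<Sum>j<k. 2 * b)" unfolding Y_def by (intro order_trans[OF sum_abs] sum_mono Wb)
    then show ?thesis by simp
  qed
  have Vb: "\<bar>V \<omega>\<bar> \<le> 2 * b" for \<omega> by (simp add: V_def Wb)
  have b: "0 \<le> b" using g[of undefined] by linarith
  have bd: "\<bar>x * y\<bar> \<le> X * Z" if "\<bar>x\<bar> \<le> X" "\<bar>y\<bar> \<le> Z" for x y X Z :: real
    unfolding abs_mult using that by (intro mult_mono) auto
  have int: "integrable M (\<lambda>\<omega>. Y \<omega> * Y \<omega>)" "integrable M (\<lambda>\<omega>. Y \<omega> * V \<omega>)" "integrable M (\<lambda>\<omega>. V \<omega> * V \<omega>)"
    by (rule integrable_bounded, intro borel_measurable_times Ym Vm, rule bd, (rule Yb Vb)+)+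
  have "expectation (\<lambda>\<omega>. Y \<omega> * V \<omega>) = 0"
    unfolding V_def W_def
  proof (rule martingale_increment)
    fix \<omega>
    show "Y \<omega> = (\<lambda>q. \<Sum>j<k. g (q (Suc (Suc (s + j)))) - (\<Sum>a\<in>UNIV. pmf (K (q (Suc (s + j)))) a * g a))
        (restrict (\<lambda>k. C k \<omega>) {1..Suc (s + k)})"
      unfolding Y_def W_def by (intro sum.cong) auto
  qed simp
  moreover have "expectation (\<lambda>\<omega>. V \<omega> * V \<omega>) \<le> 4 * b\<^sup>2"
  proof -
    have "V \<omega> * V \<omega> \<le> 4 * b\<^sup>2" for \<omega>
      using bd[OF Vb Vb, of \<omega> \<omega>] by (simp add: power2_eq_square)
    then have "expectation (\<lambda>\<omega>. V \<omega> * V \<omega>) \<le> expectation (\<lambda>\<omega>. 4 * b\<^sup>2)"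
      using int by (intro integral_mono) auto
    then show ?thesis by (simp add: prob_space)
  qed
  moreover have "expectation (\<lambda>\<omega>. (\<Sum>j<Suc k. W (Suc (s + j)) \<omega>)\<^sup>2) =
      expectation (\<lambda>\<omega>. Y \<omega> * Y \<omega> + 2 * (Y \<omega> * V \<omega>) + V \<omega> * V \<omega>)"
    by (simp add: Y_def V_def power2_eq_square algebra_simps)
  moreover have "\<dots> = expectation (\<lambda>\<omega>. Y \<omega> * Y \<omega>) + 2 * expectation (\<lambda>\<omega>. Y \<omega> * V \<omega>) + expectation (\<lambda>\<omega>. V \<omega> * V \<omega>)"
    using int by simp
  moreover have "expectation (\<lambda>\<omega>. Y \<omega> * Y \<omega>) \<le> 4 * b\<^sup>2 * real k"
    using Suc by (simp add: Y_def power2_eq_square)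
  ultimately show ?case by (simp add: algebra_simps)
qed simp

text \<open>The nonstrict inequality is the event bounded by Chebyshev's inequality; its negation
  still yields the frequency condition on a block.\<close>

definition deviates :: "('c \<Rightarrow> real) \<Rightarrow> real \<Rightarrow> nat \<Rightarrow> nat \<Rightarrow> 'c \<Rightarrow> 'w \<Rightarrow> bool" where
  "deviates p \<eta> s k a \<omega> \<longleftrightarrow> \<eta> * real k \<le> \<bar>real (card {j. j < k \<and> C (Suc (s + j)) \<omega> = a}) - real k * p a\<bar>"

lemma visits_eq_sum: "real (card {j. j < k \<and> C (Suc (s + j)) \<omega> = a}) = (\<Sum>j<k. if C (Suc (s + j)) \<omega> = a then 1 else 0)"
proof -
  have "real (card {j. j < k \<and> C (Suc (s + j)) \<omega> = a}) = (\<Sum>j\<in>{j \<in> {..<k}. C (Suc (s + j)) \<omega> = a}. 1)"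
    by simp
  also have "\<dots> = (\<Sum>j<k. if C (Suc (s + j)) \<omega> = a then 1 else 0)"
    by (rule sum.inter_filter) simp
  finally show ?thesis .
qed

lemma deviates_event: "{\<omega> \<in> space M. deviates p \<eta> s k a \<omega>} \<in> events"
proof -
  have "(\<lambda>\<omega>. real (card {j. j < k \<and> C (Suc (s + j)) \<omega> = a})) \<in> borel_measurable M"
    unfolding visits_eq_sum by (intro borel_measurable_sum C_borel) auto
  then show ?thesis
    unfolding deviates_def
    by (intro borel_measurable_le borel_measurable_abs borel_measurable_diff borel_measurable_const)
qed

text \<open>Poisson's equation for the centred indicator of \<open>a\<close> turns the deviation of
  the visit count into a martingale with bounded increments, up to two boundary terms. The constant
  \<open>\<Gamma>\<close> is the same for every starting round \<open>s\<close>; this is the source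
  of uniformity in \<open>n\<close>.\<close>

lemma frequency_deviation:
  assumes irr: "irreducible_kernel K" and inv: "bind_pmf \<mu> K = \<mu>"
  obtains \<Gamma> where "0 \<le> \<Gamma>" "\<And>s k \<eta>. 0 < k \<Longrightarrow> 0 < \<eta> \<Longrightarrow>
    \<P>(\<omega> in M. deviates (pmf \<mu>) \<eta> s k a \<omega>) \<le> \<Gamma> / (\<eta>\<^sup>2 * real k)"
proof -
  define f where "f x = (if x = a then 1 else 0) - pmf \<mu> a" for x
  have mean: "(\<Sum>x\<in>UNIV. pmf \<mu> x * f x) = 0"
  proof -
    have "(\<Sum>x\<in>UNIV. pmf \<mu> x * f x) = (\<Sum>x\<in>UNIV. if x = a then pmf \<mu> x else 0) - (\<Sum>x\<in>UNIV. pmf \<mu> x) * pmf \<mu> a"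
      unfolding f_def sum_distrib_right sum_subtractf[symmetric] by (intro sum.cong) (auto simp: algebra_simps)
    then show ?thesis by (simp add: sum_pmf_UNIV)
  qed
  obtain g where "\<forall>x. f x = g x - (\<Sum>b\<in>UNIV. pmf (K x) b * g b)"
    using poisson_equation[OF irr inv mean] ..
  then have g: "f x = g x - (\<Sum>b\<in>UNIV. pmf (K x) b * g b)" for x ..
  define b where "b = Max (range (\<lambda>x. \<bar>g x\<bar>))"
  have b: "\<bar>g x\<bar> \<le> b" for x by (simp add: b_def)
  define W where "W n \<omega> = g (C (Suc n) \<omega>) - (\<Sum>a\<in>UNIV. pmf (K (C n \<omega>)) a * g a)" for n \<omega>
  show ?thesis
  proof (rule that[of "16 * b\<^sup>2"])
    fix s k :: nat and \<eta> :: real assume k: "0 < k" and \<eta>: "0 < \<eta>"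
    define Z where "Z \<omega> = (\<Sum>j<k. f (C (Suc (s + j)) \<omega>))" for \<omega>
    define Y where "Y \<omega> = (\<Sum>j<k. W (Suc (s + j)) \<omega>)" for \<omega>
    \<comment> \<open>In \<open>W\<close> the function \<open>g\<close> is evaluated one round later
      than in \<open>f\<close>, so the difference telescopes.\<close>
    have Z: "Z \<omega> = Y \<omega> + (g (C (Suc s) \<omega>) - g (C (Suc (s + k)) \<omega>))" for \<omega>
      unfolding Z_def Y_def W_def by (induction k) (simp_all add: g)
    have Zm: "Z \<in> borel_measurable M" unfolding Z_def by (intro borel_measurable_sum C_borel) auto
    have Ym: "Y \<in> borel_measurable M"
      unfolding Y_def W_def by (intro borel_measurable_sum borel_measurable_diff C_borel) auto
    have Zb: "\<bar>Z \<omega>\<bar> \<le> real k" for \<omega>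
    proof -
      have "\<bar>f x\<bar> \<le> 1" for x using pmf_le_1[of \<mu> a] by (auto simp: f_def)
      then have "\<bar>Z \<omega>\<bar> \<le> (\<Sum>j<k. 1)" unfolding Z_def by (intro order_trans[OF sum_abs] sum_mono)
      then show ?thesis by simp
    qed
    have e: "\<bar>g (C (Suc s) \<omega>) - g (C (Suc (s + k)) \<omega>)\<bar> \<le> 2 * b" for \<omega>
      using b[of "C (Suc s) \<omega>"] b[of "C (Suc (s + k)) \<omega>"] by linarith
    have Yb: "\<bar>Y \<omega>\<bar> \<le> real k + 2 * b" for \<omega> using Z[of \<omega>] Zb[of \<omega>] e[of \<omega>] by linarith
    have sq: "x\<^sup>2 \<le> X\<^sup>2" if "\<bar>x\<bar> \<le> X" for x X :: real using that by (simp add: abs_le_square_iff[symmetric])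
    have intZ: "integrable M (\<lambda>\<omega>. (Z \<omega>)\<^sup>2)"
      by (rule integrable_bounded[of _ "(real k)\<^sup>2"]) (use Zm sq[OF Zb] in auto)
    have intY: "integrable M (\<lambda>\<omega>. (Y \<omega>)\<^sup>2)"
      by (rule integrable_bounded[of _ "(real k + 2 * b)\<^sup>2"]) (use Ym sq[OF Yb] in auto)
    have "(Z \<omega>)\<^sup>2 \<le> 2 * (Y \<omega>)\<^sup>2 + 8 * b\<^sup>2" for \<omega>
    proof -
      have "(y + e)\<^sup>2 \<le> 2 * y\<^sup>2 + 2 * e\<^sup>2" for y e :: real
        using zero_le_power2[of "y - e"] by (simp add: power2_eq_square algebra_simps)
      then have "(Z \<omega>)\<^sup>2 \<le> 2 * (Y \<omega>)\<^sup>2 + 2 * (g (C (Suc s) \<omega>) - g (C (Suc (s + k)) \<omega>))\<^sup>2"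
        unfolding Z .
      then show ?thesis using sq[OF e, of \<omega>] by (simp add: power_mult_distrib)
    qed
    then have "expectation (\<lambda>\<omega>. (Z \<omega>)\<^sup>2) \<le> expectation (\<lambda>\<omega>. 2 * (Y \<omega>)\<^sup>2 + 8 * b\<^sup>2)"
      using intZ intY by (intro integral_mono) auto
    also have "\<dots> = 2 * expectation (\<lambda>\<omega>. (Y \<omega>)\<^sup>2) + 8 * b\<^sup>2"
      using intY by (simp add: prob_space)
    also have "expectation (\<lambda>\<omega>. (Y \<omega>)\<^sup>2) \<le> 4 * b\<^sup>2 * real k"
      unfolding Y_def W_def by (rule martingale_variance[OF b])
    \<comment> \<open>The summand \<open>8 * b\<^sup>2\<close> of the boundary terms is absorbed
      because \<open>k \<ge> 1\<close>.\<close>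
    also have "2 * (4 * b\<^sup>2 * real k) + 8 * b\<^sup>2 \<le> 16 * b\<^sup>2 * real k"
    proof -
      have "8 * b\<^sup>2 * 1 \<le> 8 * b\<^sup>2 * real k" using k by (intro mult_left_mono) auto
      then show ?thesis by (simp add: algebra_simps)
    qed
    finally have var: "expectation (\<lambda>\<omega>. (Z \<omega>)\<^sup>2) \<le> 16 * b\<^sup>2 * real k" by simp
    have "real (card {j. j < k \<and> C (Suc (s + j)) \<omega> = a}) - real k * pmf \<mu> a = Z \<omega>" for \<omega>
      unfolding visits_eq_sum Z_def f_def by (simp add: sum_subtractf)
    then have "\<P>(\<omega> in M. deviates (pmf \<mu>) \<eta> s k a \<omega>) = \<P>(\<omega> in M. \<eta> * real k \<le> \<bar>Z \<omega>\<bar>)"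
      by (simp add: deviates_def)
    also have "\<dots> \<le> expectation (\<lambda>\<omega>. (Z \<omega>)\<^sup>2) / (\<eta> * real k)\<^sup>2"
      using k \<eta> Zm intZ by (intro second_moment_method) auto
    also have "\<dots> \<le> 16 * b\<^sup>2 * real k / (\<eta> * real k)\<^sup>2"
      using var by (intro divide_right_mono) auto
    also have "\<dots> = 16 * b\<^sup>2 / (\<eta>\<^sup>2 * real k)" using k by (simp add: power2_eq_square)
    finally show "\<P>(\<omega> in M. deviates (pmf \<mu>) \<eta> s k a \<omega>) \<le> 16 * b\<^sup>2 / (\<eta>\<^sup>2 * real k)" .
  qed simp
qed

end

subsection \<open>Convergence of the algorithm\<close>

lemma compact_positive_bounds:
  fixes \<F> :: "('x::topological_space \<Rightarrow> real) set"
  assumes "finite \<F>" "compact K" "\<And>f. f \<in> \<F> \<Longrightarrow> continuous_on K f"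
    "\<And>f x. f \<in> \<F> \<Longrightarrow> x \<in> K \<Longrightarrow> 0 < f x"
  shows "\<exists>l B. 0 < l \<and> (\<forall>f\<in>\<F>. \<forall>x\<in>K. f x \<in> {l..B})"
  using assms(1,3,4)
proof (induction \<F> rule: finite_induct)
  case empty
  show ?case by (auto intro: exI[of _ 1])
next
  case (insert f \<F>)
  then obtain l B where lB: "0 < l" "\<forall>f\<in>\<F>. \<forall>x\<in>K. f x \<in> {l..B}" by auto
  show ?case
  proof (cases "K = {}")
    case False
    have f: "continuous_on K f" using insert by auto
    obtain x where x: "x \<in> K" "\<forall>y\<in>K. f x \<le> f y" using continuous_attains_inf[OF assms(2) False f] by blast
    obtain y where y: "y \<in> K" "\<forall>z\<in>K. f z \<le> f y" using continuous_attains_sup[OF assms(2) False f] by blast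
    have "0 < f x" using insert x by auto
    then have "0 < min l (f x)" "\<forall>g\<in>insert f \<F>. \<forall>z\<in>K. g z \<in> {min l (f x)..max B (f y)}"
      using lB x y by (auto simp: min_le_iff_disj le_max_iff_disj)
    then show ?thesis by blast
  qed (auto intro: exI[of _ 1])
qed

lemma is_norm_convex:
  assumes "is_norm N" shows "convex_on UNIV N"
proof (rule convex_onI)
  fix t :: real and x y assume t: "0 < t" "t < 1"
  have "N ((1 - t) *\<^sub>R x + t *\<^sub>R y) \<le> N ((1 - t) *\<^sub>R x) + N (t *\<^sub>R y)"
    using assms unfolding is_norm_def by blast
  also have "\<dots> = (1 - t) * N x + t * N y"
    using assms t unfolding is_norm_def by simp
  finally show "N ((1 - t) *\<^sub>R x + t *\<^sub>R y) \<le> (1 - t) * N x + t * N y" .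
qed simp

lemma is_norm_diff:
  assumes "is_norm N" shows "\<bar>N (x + s *\<^sub>R v) - N x\<bar> \<le> \<bar>s\<bar> * N v"
proof -
  have tri: "N (a + b) \<le> N a + N b" and hom: "N (c *\<^sub>R a) = \<bar>c\<bar> * N a" for a b c
    using assms unfolding is_norm_def by blast+
  have "N x \<le> N (x + s *\<^sub>R v) + N ((- s) *\<^sub>R v)" using tri[of "x + s *\<^sub>R v" "(- s) *\<^sub>R v"] by simp
  moreover have "N (x + s *\<^sub>R v) \<le> N x + N (s *\<^sub>R v)" by (rule tri)
  ultimately show ?thesis unfolding hom by simp
qed

section \<open>The optimization problem in the coordinates of h\<close>

locale nac_problem =
  fixes qmax :: real and N :: "real ^ 'm \<Rightarrow> real" and h :: "real \<Rightarrow> real"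
    and dur :: "real ^ 'm \<Rightarrow> 'c::finite \<Rightarrow> real" and \<mu> :: "'c pmf" and \<pi>s :: "'c \<Rightarrow> real ^ 'm"
  assumes qmax: "0 < qmax"
    and dur_pos: "\<And>q c. q \<in> qbox qmax \<Longrightarrow> 0 < dur q c"
    and norm: "is_norm N"
    and h_mono: "strict_mono_on {0..qmax} h" and h_cont: "continuous_on {0..qmax} h"
    and h_pos: "\<And>x. x \<in> {0..qmax} \<Longrightarrow> 0 < h x"
    and dur_regular: "duration_regular qmax h dur"
    and quasiconvex: "objective_quasiconvex qmax N h dur \<mu>"
    and optimal: "is_arg_min (t_hat N h dur \<mu>) (\<lambda>\<pi>. \<pi> \<in> policies qmax) \<pi>s"
    and support: "\<And>c. 0 < pmf \<mu> c"
begin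

definition X :: "(real ^ 'm) set" where "X = hvec h ` qbox qmax"

definition D :: "'c \<Rightarrow> real ^ 'm \<Rightarrow> real" where "D c r = dur (hinv qmax h r) c"

sublocale policy_objective X N D "pmf \<mu>" .

lemma h_image: "h ` {0..qmax} = {h 0..h qmax}"
proof
  show "h ` {0..qmax} \<subseteq> {h 0..h qmax}"
    using strict_mono_on_leD[OF h_mono] qmax by force
  show "{h 0..h qmax} \<subseteq> h ` {0..qmax}"
  proof
    fix y assume "y \<in> {h 0..h qmax}"
    then show "y \<in> h ` {0..qmax}"
      using IVT'[of h 0 y qmax] h_cont qmax by force
  qed
qed

lemma hinv_hvec: "q \<in> qbox qmax \<Longrightarrow> hinv qmax h (hvec h q) = q"
  using strict_mono_on_imp_inj_on[OF h_mono]
  by (simp add: hinv_def hvec_def qbox_def vec_eq_iff)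

lemma hvec_hinv: "r \<in> X \<Longrightarrow> hvec h (hinv qmax h r) = r"
  by (auto simp: X_def hinv_hvec)

lemma hinv_in: "r \<in> X \<Longrightarrow> hinv qmax h r \<in> qbox qmax"
  by (auto simp: X_def hinv_hvec)

lemma D_hvec: "q \<in> qbox qmax \<Longrightarrow> D c (hvec h q) = dur q c"
  by (simp add: D_def hinv_hvec)

lemma X_eq: "X = cbox (\<chi> i. h 0) (\<chi> i. h qmax)"
proof -
  have "X = {r. \<forall>i. r $ i \<in> h ` {0..qmax}}"
  proof (intro equalityI subsetI)
    fix r :: "real ^ 'm" assume "r \<in> {r. \<forall>i. r $ i \<in> h ` {0..qmax}}"
    then have "\<forall>i. \<exists>q\<in>{0..qmax}. r $ i = h q" by auto
    then obtain q where q: "\<And>i. q i \<in> {0..qmax}" "\<And>i. r $ i = h (q i)" by metis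
    then have "r = hvec h (\<chi> i. q i)" "(\<chi> i. q i) \<in> qbox qmax"
      by (auto simp: hvec_def qbox_def vec_eq_iff)
    then show "r \<in> X" by (auto simp: X_def)
  qed (auto simp: X_def hvec_def qbox_def)
  then show ?thesis by (auto simp: h_image mem_box_cart)
qed

lemma X_nonempty: "X \<noteq> {}"
proof -
  have "(\<chi> i. 0) \<in> qbox qmax" using qmax by (simp add: qbox_def)
  then show ?thesis by (auto simp: X_def)
qed

lemma compact_X: "compact X" and convex_X: "convex X"
  by (auto simp: X_eq)

lemma N_pos: "r \<in> X \<Longrightarrow> 0 < N r"
proof -
  assume "r \<in> X"
  then have "0 < r $ i" for i using h_pos by (auto simp: X_def hvec_def qbox_def)
  then have "r \<noteq> 0" by (metis less_irrefl zero_index)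
  then show "0 < N r" using norm unfolding is_norm_def by (metis less_eq_real_def)
qed

lemma D_pos: "r \<in> X \<Longrightarrow> 0 < D c r"
  by (simp add: D_def dur_pos hinv_in)

lemma convex_N: "convex_on X N"
  using is_norm_convex[OF norm] convex_X by (auto intro: convex_on_subset)

lemma convex_D: "convex_on X (D c)"
  using dur_regular unfolding duration_regular_def X_def D_def[abs_def] by (simp add: Let_def)

lemma cont_N: "continuous_on A N"
  using convex_on_continuous[OF open_UNIV is_norm_convex[OF norm]] by (rule continuous_on_subset) simp

lemma S_eq: "S = policy_vec h ` policies qmax"
proof (intro equalityI subsetI)
  fix x assume "x \<in> S"
  then have "x = policy_vec h (\<lambda>c. hinv qmax h (x $ c))" "(\<lambda>c. hinv qmax h (x $ c)) \<in> policies qmax"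
    by (auto simp: S_def policy_vec_def policies_def hvec_hinv hinv_in vec_eq_iff)
  then show "x \<in> policy_vec h ` policies qmax" by blast
qed (auto simp: S_def policy_vec_def policies_def, auto simp: X_def)

lemma mean_rounds_policy: "mean_rounds N h \<mu> \<pi> = F (policy_vec h \<pi>)"
  by (simp add: mean_rounds_def F_def policy_vec_def integral_measure_pmf_real[of UNIV] mult.commute)

lemma mean_duration_policy:
  "\<pi> \<in> policies qmax \<Longrightarrow> mean_duration dur \<mu> \<pi> = G (policy_vec h \<pi>)"
  by (simp add: mean_duration_def G_def policy_vec_def integral_measure_pmf_real[of UNIV]
      mult.commute policies_def D_hvec)

lemma t_hat_policy: "\<pi> \<in> policies qmax \<Longrightarrow> t_hat N h dur \<mu> \<pi> = F (policy_vec h \<pi>) * G (policy_vec h \<pi>)"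
  by (simp add: t_hat_def mean_rounds_policy mean_duration_policy)

definition t :: "real ^ 'm ^ 'c \<Rightarrow> real" where
  "t r = t_hat N h dur \<mu> (\<lambda>c. hinv qmax h (r $ c))"

lemma t_eq: "x \<in> S \<Longrightarrow> t x = F x * G x"
proof -
  assume x: "x \<in> S"
  then have "(\<lambda>c. hinv qmax h (x $ c)) \<in> policies qmax"
    and "policy_vec h (\<lambda>c. hinv qmax h (x $ c)) = x"
    by (auto simp: S_def policy_vec_def policies_def hvec_hinv hinv_in vec_eq_iff)
  then show ?thesis by (simp add: t_def t_hat_policy)
qed

lemma t_quasiconvex: "strictly_quasiconvex_on S t"
  using quasiconvex unfolding objective_quasiconvex_def S_eq t_def[abs_def] .

lemma F_pos: "x \<in> S \<Longrightarrow> 0 < F x"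
  unfolding F_def using support N_pos by (intro sum_pos) (auto simp: S_def)

lemma cont_F: "continuous_on S F"
  unfolding F_def by (intro continuous_intros continuous_on_compose2[OF cont_N[of UNIV]]) auto

text \<open>Convexity does not exclude jumps at the boundary of the box. Continuity comes instead
  from the differentiability of the objective, divided by the continuous positive factor
  \<open>F\<close>.\<close>

lemma cont_G: "continuous_on S G"
proof -
  have "continuous_on S t"
    using t_quasiconvex unfolding strictly_quasiconvex_on_def
    by (metis has_derivative_continuous continuous_on_eq_continuous_within)
  then have "continuous_on S (\<lambda>x. t x / F x)"
    using F_pos by (intro continuous_on_divide cont_F) fastforce+
  then show ?thesis
    by (rule continuous_on_eq) (use F_pos t_eq in fastforce)
qed

text \<open>Varying a policy at the state \<open>c\<close> alone isolates \<open>D c\<close> in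
  \<open>G\<close>, since \<open>c\<close> has positive probability.\<close>

lemma cont_D: "continuous_on X (D c)"
proof -
  obtain x0 where x0: "x0 \<in> X" using X_nonempty by blast
  define e :: "real ^ 'm \<Rightarrow> real ^ 'm ^ 'c" where "e r = (\<chi> c'. if c' = c then r else x0)" for r
  have "continuous_on X e"
    unfolding e_def
  proof (intro continuous_on_vec_lambda)
    fix c' show "continuous_on X (\<lambda>r. if c' = c then r else x0)"
      by (cases "c' = c") (simp_all add: continuous_on_id continuous_on_const)
  qed
  moreover have "e ` X \<subseteq> S" using x0 by (auto simp: e_def S_def)
  ultimately have "continuous_on X (\<lambda>r. G (e r))" using continuous_on_compose2[OF cont_G] by blast
  then have "continuous_on X (\<lambda>r. (G (e r) - (\<Sum>c'\<in>UNIV - {c}. pmf \<mu> c' * D c' x0)) / pmf \<mu> c)"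
    using support[of c] by (intro continuous_intros) auto
  moreover have "(G (e r) - (\<Sum>c'\<in>UNIV - {c}. pmf \<mu> c' * D c' x0)) / pmf \<mu> c = D c r" for r
  proof -
    have "G (e r) = pmf \<mu> c * D c r + (\<Sum>c'\<in>UNIV - {c}. pmf \<mu> c' * D c' (e r $ c'))"
      unfolding G_def by (subst sum.remove[of UNIV c]) (auto simp: e_def)
    also have "(\<Sum>c'\<in>UNIV - {c}. pmf \<mu> c' * D c' (e r $ c')) = (\<Sum>c'\<in>UNIV - {c}. pmf \<mu> c' * D c' x0)"
      by (intro sum.cong) (auto simp: e_def)
    finally show ?thesis using support[of c] by simp
  qed
  ultimately show ?thesis by simp
qed

lemma convex_S: "convex S"
  using convex_X unfolding convex_alt S_def by auto

definition xs :: "real ^ 'm ^ 'c" where "xs = policy_vec h \<pi>s"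

lemma xs_S: "xs \<in> S"
  using optimal by (auto simp: xs_def S_eq is_arg_min_def)

lemma xs_minimal: "x \<in> S \<Longrightarrow> F xs * G xs \<le> F x * G x"
  using optimal t_hat_policy unfolding is_arg_min_def S_eq xs_def by force

text \<open>
  Neither factor of the objective needs to be differentiable.  Along a segment issuing from
  \<open>x\<close>, \<open>F\<close> is Lipschitz and \<open>G\<close> is continuous, so the objective differs from its linearization
  by the cross term, which is of smaller order than the step.
\<close>

lemma stationary_optimal:
  assumes x: "x \<in> S" and st: "\<And>y. y \<in> S \<Longrightarrow> 2 * F x * G x \<le> G x * F y + F x * G y"
  shows "x = xs"
proof (rule ccontr)
  assume ne: "x \<noteq> xs"
  define v where "v = xs - x"
  define L where "L = (\<Sum>c\<in>UNIV. pmf \<mu> c * N (v $ c))"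
  define z where "z s = x + s *\<^sub>R v" for s
  \<comment> \<open>The bound on the cross term divided by \<open>s\<close>: \<open>L\<close> is a
    Lipschitz constant of \<open>F\<close> along the segment.\<close>
  define e where "e s = L * \<bar>G (z s) - G x\<bar>" for s
  have zS: "z s \<in> S" if "s \<in> {0..1}" for s
  proof -
    have "z s = (1 - s) *\<^sub>R x + s *\<^sub>R xs" by (simp add: z_def v_def algebra_simps)
    then show ?thesis using convex_S x xs_S that by (auto simp: convex_alt)
  qed
  have "t x < t xs"
  proof (rule strictly_quasiconvex_on_less[OF t_quasiconvex convex_S x xs_S ne])
    fix s :: real assume s: "0 < s" "s \<le> 1"
    have z: "z s \<in> S" using zS s by simp
    have "\<bar>F (z s) - F x\<bar> \<le> (\<Sum>c\<in>UNIV. pmf \<mu> c * (s * N (v $ c)))"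
    proof -
      have "F (z s) - F x = (\<Sum>c\<in>UNIV. pmf \<mu> c * (N (x $ c + s *\<^sub>R v $ c) - N (x $ c)))"
        by (simp add: F_def z_def sum_subtractf right_diff_distrib)
      also have "\<bar>\<dots>\<bar> \<le> (\<Sum>c\<in>UNIV. pmf \<mu> c * (s * N (v $ c)))"
        using is_norm_diff[OF norm, of _ s] abs_of_pos[OF s(1)]
        by (intro order_trans[OF sum_abs] sum_mono) (simp add: abs_mult mult_left_mono)
      finally show ?thesis .
    qed
    also have "\<dots> = s * L" by (simp add: L_def sum_distrib_left mult_ac)
    finally have "\<bar>(F (z s) - F x) * (G (z s) - G x)\<bar> \<le> s * L * \<bar>G (z s) - G x\<bar>"
      unfolding abs_mult by (intro mult_right_mono) auto
    moreover have "F (z s) * G (z s) = F x * G x + (G x * F (z s) + F x * G (z s) - 2 * F x * G x)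
        + (F (z s) - F x) * (G (z s) - G x)" by (simp add: algebra_simps)
    ultimately have "F x * G x - s * e s \<le> F (z s) * G (z s)"
      using st[OF z] by (simp add: e_def abs_le_iff)
    then show "t x - s * e s \<le> t (x + s *\<^sub>R (xs - x))"
      using t_eq[OF x] t_eq[OF z] by (simp add: z_def v_def)
  next
    have "continuous_on {0..1} z" unfolding z_def by (intro continuous_intros)
    then have "continuous_on {0..1} (\<lambda>s. G (z s))"
      using zS by (intro continuous_on_compose2[OF cont_G]) auto
    then have "continuous_on {0..1} e" unfolding e_def by (intro continuous_intros)
    then have "(e \<longlongrightarrow> e 0) (at 0 within {0..1})" unfolding continuous_on_def by simp
    then show "(e \<longlongrightarrow> 0) (at_right 0)" by (simp add: at_within_Icc_at_right e_def z_def)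
  qed
  then show False using xs_minimal[OF x] t_eq x xs_S by simp
qed

text \<open>A second minimizer meets the hypothesis of \<open>strictly_quasiconvex_on_less\<close>
  without any error term and would be strictly better than \<open>xs\<close>.\<close>

lemma minimal_unique:
  assumes x: "x \<in> S" and eq: "F x * G x = F xs * G xs"
  shows "x = xs"
proof (rule ccontr)
  assume ne: "x \<noteq> xs"
  have "t x < t xs"
  proof (rule strictly_quasiconvex_on_less[OF t_quasiconvex convex_S x xs_S ne, where e = "\<lambda>_. 0"])
    fix s :: real assume s: "0 < s" "s \<le> 1"
    have "x + s *\<^sub>R (xs - x) = (1 - s) *\<^sub>R x + s *\<^sub>R xs" by (simp add: algebra_simps)
    then have z: "x + s *\<^sub>R (xs - x) \<in> S" using convex_S x xs_S s by (auto simp: convex_alt)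
    show "t x - s * 0 \<le> t (x + s *\<^sub>R (xs - x))"
      using xs_minimal[OF z] eq t_eq[OF z] t_eq[OF x] by simp
  qed simp
  then show False using eq t_eq x xs_S by simp
qed

lemma unique_optimum_exists:
  assumes "0 < r0" "0 < d0"
  obtains l B where "unique_optimum X N D (pmf \<mu>) l B (mean_rounds N h \<mu> \<pi>s) (mean_duration dur \<mu> \<pi>s)"
    "r0 \<in> {l..B}" "d0 \<in> {l..B}"
proof -
  \<comment> \<open>The constants make the bounds cover the initial estimates and force \<open>1 \<le> B\<close>.\<close>
  define \<F> where "\<F> = {N, \<lambda>_. r0, \<lambda>_. d0, \<lambda>_. 1} \<union> range D"
  have "\<exists>l B. 0 < l \<and> (\<forall>f\<in>\<F>. \<forall>x\<in>X. f x \<in> {l..B})"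
    using assms N_pos D_pos
    by (intro compact_positive_bounds compact_X) (auto simp: \<F>_def intro: cont_N cont_D)
  then obtain l B where l: "0 < l" and lB: "\<And>f x. f \<in> \<F> \<Longrightarrow> x \<in> X \<Longrightarrow> f x \<in> {l..B}" by blast
  obtain x0 where x0: "x0 \<in> X" using X_nonempty by blast
  have rd: "1 \<in> {l..B}" "r0 \<in> {l..B}" "d0 \<in> {l..B}"
    using lB[OF _ x0, of "\<lambda>_. 1"] lB[OF _ x0, of "\<lambda>_. r0"] lB[OF _ x0, of "\<lambda>_. d0"]
    by (auto simp: \<F>_def)
  interpret policy_space X N D "pmf \<mu>" l B
    by unfold_locales (use l lB rd compact_X convex_X X_nonempty convex_N convex_D cont_N cont_D
        in \<open>auto simp: \<F>_def sum_pmf_UNIV\<close>)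
  have "unique_optimum X N D (pmf \<mu>) l B (F xs) (G xs)"
    by unfold_locales (use stationary_optimal minimal_unique xs_minimal in auto)
  moreover have "mean_rounds N h \<mu> \<pi>s = F xs" "mean_duration dur \<mu> \<pi>s = G xs"
    using optimal by (auto simp: xs_def mean_rounds_policy mean_duration_policy is_arg_min_def)
  ultimately show ?thesis using rd that by simp
qed

lemma nac_run_of_nac_fl_run:
  assumes space: "policy_space X N D (pmf \<mu>) l B"
    and run: "nac_fl_run qmax N h dur (\<lambda>_. \<beta>) r0 d0 c q r d"
    and init: "r0 \<in> {l..B}" "d0 \<in> {l..B}"
  shows "policy_space.nac_run X N D l B \<beta> c (\<lambda>n. hvec h (q n)) r d"
proof -
  interpret policy_space X N D "pmf \<mu>" l B by (rule space)
  have r0: "r 0 = r0" "d 0 = d0"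
    and step: "is_arg_min (\<lambda>x. r n * dur x (c (Suc n)) + d n * N (hvec h x))
          (\<lambda>x. x \<in> qbox qmax) (q (Suc n))"
      "r (Suc n) = (1 - \<beta>) * r n + \<beta> * N (hvec h (q (Suc n)))"
      "d (Suc n) = (1 - \<beta>) * d n + \<beta> * dur (q (Suc n)) (c (Suc n))" for n
    using run[unfolded nac_fl_run_def] by (auto dest: spec[of _ "Suc n"])
  have q: "q (Suc n) \<in> qbox qmax" for n using step(1)[of n] by (simp add: is_arg_min_def)
  have opt: "r n * D (c (Suc n)) (hvec h (q (Suc n))) + d n * N (hvec h (q (Suc n)))
      \<le> r n * D (c (Suc n)) y + d n * N y" if "y \<in> X" for n y
  proof -
    obtain x where x: "x \<in> qbox qmax" "y = hvec h x" using \<open>y \<in> X\<close> by (auto simp: X_def)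
    then show ?thesis using step(1)[of n] by (auto simp: is_arg_min_def D_hvec[OF q] D_hvec not_less)
  qed
  show ?thesis
    unfolding nac_run_def
    using r0 init step(2,3) q opt by (auto simp: D_hvec[OF q] X_def)
qed

end

section \<open>Atypical blocks and the limit\<close>

lemma (in finite_markov_chain) union_deviates:
  assumes \<Gamma>: "\<And>s a. \<P>(\<omega> in M. deviates p \<eta> s k a \<omega>) \<le> \<Gamma> a"
  shows "{\<omega> \<in> space M. \<exists>i<J. \<exists>a. deviates p \<eta> (s + i * k) k a \<omega>} \<in> events"
    and "\<P>(\<omega> in M. \<exists>i<J. \<exists>a. deviates p \<eta> (s + i * k) k a \<omega>) \<le> real J * (\<Sum>a\<in>UNIV. \<Gamma> a)"
proof -
  define E where "E i a = {\<omega> \<in> space M. deviates p \<eta> (s + i * k) k a \<omega>}" for i a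
  have eq: "{\<omega> \<in> space M. \<exists>i<J. \<exists>a. deviates p \<eta> (s + i * k) k a \<omega>} = (\<Union>i\<in>{..<J}. \<Union>a. E i a)"
    by (auto simp: E_def)
  have E: "E i a \<in> events" for i a unfolding E_def by (rule deviates_event)
  then show "{\<omega> \<in> space M. \<exists>i<J. \<exists>a. deviates p \<eta> (s + i * k) k a \<omega>} \<in> events"
    unfolding eq by (intro sets.finite_UN) auto
  have "prob (\<Union>i\<in>{..<J}. \<Union>a. E i a) \<le> (\<Sum>i<J. prob (\<Union>a. E i a))"
    using E by (intro finite_measure_subadditive_finite) auto
  also have "\<dots> \<le> (\<Sum>i<J. \<Sum>a\<in>UNIV. \<Gamma> a)"
  proof (rule sum_mono)
    fix i
    have "prob (\<Union>a. E i a) \<le> (\<Sum>a\<in>UNIV. prob (E i a))"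
      using E by (intro finite_measure_subadditive_finite) auto
    also have "\<dots> \<le> (\<Sum>a\<in>UNIV. \<Gamma> a)" unfolding E_def by (intro sum_mono \<Gamma>)
    finally show "prob (\<Union>a. E i a) \<le> (\<Sum>a\<in>UNIV. \<Gamma> a)" .
  qed
  finally show "\<P>(\<omega> in M. \<exists>i<J. \<exists>a. deviates p \<eta> (s + i * k) k a \<omega>) \<le> real J * (\<Sum>a\<in>UNIV. \<Gamma> a)"
    unfolding eq by simp
qed

text \<open>Rounding down loses less than \<open>\<beta>\<close>, which is at most half of
  \<open>\<delta>\<close>.\<close>

lemma block_length:
  fixes \<beta> \<delta> :: real
  assumes "0 < \<beta>" "\<beta> \<le> \<delta> / 2"
  defines "k \<equiv> nat \<lfloor>\<delta> / \<beta>\<rfloor>"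
  shows "\<delta> / 2 \<le> real k * \<beta>" "real k * \<beta> \<le> \<delta>" "0 < k"
proof -
  have "0 \<le> \<delta> / \<beta>" using assms by simp
  then have k: "real k = of_int \<lfloor>\<delta> / \<beta>\<rfloor>" by (simp add: k_def)
  have "\<delta> / \<beta> - 1 < real k" "real k \<le> \<delta> / \<beta>" unfolding k by linarith+
  then have "\<delta> - \<beta> < real k * \<beta>" and *: "real k * \<beta> \<le> \<delta>"
    using assms(1) by (simp_all add: field_simps)
  then show "\<delta> / 2 \<le> real k * \<beta>" using assms by simp
  moreover have "0 < \<delta>" using assms by linarith
  ultimately show "0 < k" by (cases k) auto
  show "real k * \<beta> \<le> \<delta>" by (rule *)
qed

theorem theorem1:
  fixes qmax \<epsilon> r0 d0 :: real
    and \<tau> :: nat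
    and N :: "real ^ 'm \<Rightarrow> real"
    and h :: "real \<Rightarrow> real \<Rightarrow> real"
    and reached :: "real \<Rightarrow> (nat \<Rightarrow> real ^ 'm) \<Rightarrow> nat \<Rightarrow> bool"
    and d :: "nat \<Rightarrow> real ^ 'm \<Rightarrow> 'c :: finite \<Rightarrow> real"
    and M :: "'w measure"
    and K :: "'c \<Rightarrow> 'c pmf"
    and \<mu> :: "'c pmf"
    and C :: "nat \<Rightarrow> 'w \<Rightarrow> 'c"
    and \<pi>s :: "'c \<Rightarrow> real ^ 'm"
    and Q :: "real \<Rightarrow> nat \<Rightarrow> 'w \<Rightarrow> real ^ 'm"
    and Rhat Dhat :: "real \<Rightarrow> nat \<Rightarrow> 'w \<Rightarrow> real"
  assumes "0 < qmax" and "0 < \<epsilon>"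
    and "\<And>q c. q \<in> qbox qmax \<Longrightarrow> 0 < d \<tau> q c"
    and "rounds_model qmax N h reached"
    and "rounds_growth qmax reached"
    and "duration_regular qmax (h \<epsilon>) (d \<tau>)"
    and "stationary_ergodic_chain M K \<mu> C"
    and "objective_quasiconvex qmax N (h \<epsilon>) (d \<tau>) \<mu>"
    and "is_arg_min (t_hat N (h \<epsilon>) (d \<tau>) \<mu>) (\<lambda>\<pi>. \<pi> \<in> policies qmax) \<pi>s"
    and "0 < r0" and "0 < d0"
    and "\<And>\<beta> \<omega>. 0 < \<beta> \<Longrightarrow> \<beta> < 1 \<Longrightarrow> \<omega> \<in> space M \<Longrightarrow>
           nac_fl_run qmax N (h \<epsilon>) (d \<tau>) (\<lambda>_. \<beta>) r0 d0 (\<lambda>n. C n \<omega>)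
             (\<lambda>n. Q \<beta> n \<omega>) (\<lambda>n. Rhat \<beta> n \<omega>) (\<lambda>n. Dhat \<beta> n \<omega>)"
    and "\<And>\<beta> n. 0 < \<beta> \<Longrightarrow> \<beta> < 1 \<Longrightarrow> Rhat \<beta> n \<in> borel_measurable M"
    and "\<And>\<beta> n. 0 < \<beta> \<Longrightarrow> \<beta> < 1 \<Longrightarrow> Dhat \<beta> n \<in> borel_measurable M"
  shows "\<exists>\<beta> :: nat \<Rightarrow> real.
    (\<forall>i. 0 < \<beta> i \<and> \<beta> i < 1) \<and> \<beta> \<longlonglongrightarrow> 0 \<and>
    (\<forall>\<rho>>0. \<exists>nth :: real.
       (\<lambda>i. SUP n\<in>{n. real n \<ge> nth / \<beta> i}.
          \<P>(\<omega> in M. norm (Rhat (\<beta> i) n \<omega> - mean_rounds N (h \<epsilon>) \<mu> \<pi>s,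
                          Dhat (\<beta> i) n \<omega> - mean_duration (d \<tau>) \<mu> \<pi>s) > \<rho>)) \<longlonglongrightarrow> 0)"
proof -
  interpret nac_problem qmax N "h \<epsilon>" "d \<tau>" \<mu> \<pi>s
  proof unfold_locales
    show "0 < pmf \<mu> c" for c
      using assms(7) by (auto simp: stationary_ergodic_chain_def intro: irreducible_support)
  qed (use assms in \<open>auto simp: rounds_model_def\<close>)
  interpret prob_space M
    using assms(7) by (simp add: stationary_ergodic_chain_def markov_chain_def)
  interpret finite_markov_chain M K C
    using assms(7) by unfold_locales (simp add: stationary_ergodic_chain_def)
  define us where "us = mean_rounds N (h \<epsilon>) \<mu> \<pi>s"
  define vs where "vs = mean_duration (d \<tau>) \<mu> \<pi>s"
  obtain l B where opt: "unique_optimum X N D (pmf \<mu>) l B us vs"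
    and init: "r0 \<in> {l..B}" "d0 \<in> {l..B}"
    unfolding us_def vs_def using unique_optimum_exists[OF assms(10,11)] by metis
  interpret unique_optimum X N D "pmf \<mu>" l B us vs by (rule opt)
  have run: "nac_run \<beta> (\<lambda>n. C n \<omega>) (\<lambda>n. hvec (h \<epsilon>) (Q \<beta> n \<omega>)) (\<lambda>n. Rhat \<beta> n \<omega>) (\<lambda>n. Dhat \<beta> n \<omega>)"
    if "0 < \<beta>" "\<beta> < 1" "\<omega> \<in> space M" for \<beta> \<omega>
    by (rule nac_run_of_nac_fl_run[OF policy_space_axioms assms(12)[OF that] init])
  have "\<exists>\<Gamma>\<ge>0. \<forall>s k \<eta>. 0 < k \<longrightarrow> 0 < \<eta> \<longrightarrow>
      \<P>(\<omega> in M. deviates (pmf \<mu>) \<eta> s k a \<omega>) \<le> \<Gamma> / (\<eta>\<^sup>2 * real k)" for a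
    using frequency_deviation[of \<mu> a] assms(7) unfolding stationary_ergodic_chain_def by metis
  then obtain \<Gamma> where \<Gamma>0: "\<And>a. 0 \<le> \<Gamma> a" and \<Gamma>: "\<And>a s k \<eta>. 0 < k \<Longrightarrow> 0 < \<eta> \<Longrightarrow>
      \<P>(\<omega> in M. deviates (pmf \<mu>) \<eta> s k a \<omega>) \<le> \<Gamma> a / (\<eta>\<^sup>2 * real k)" by metis
  \<comment> \<open>The argument uses only that the step sizes lie in \<open>(0, 1)\<close> and tend
    to 0; the shift by 2 keeps the first one below 1.\<close>
  define \<beta> where "\<beta> i = 1 / (real i + 2)" for i
  have \<beta>: "0 < \<beta> i" "\<beta> i < 1" for i by (auto simp: \<beta>_def)
  have \<beta>_lim: "\<beta> \<longlonglongrightarrow> 0"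
    using LIMSEQ_ignore_initial_segment[OF LIMSEQ_inverse_real_of_nat, of 1]
    by (simp add: \<beta>_def[abs_def] inverse_eq_divide add.commute)
  have "\<exists>nth :: real. (\<lambda>i. SUP n\<in>{n. real n \<ge> nth / \<beta> i}.
      \<P>(\<omega> in M. norm (Rhat (\<beta> i) n \<omega> - us, Dhat (\<beta> i) n \<omega> - vs) > \<rho>)) \<longlonglongrightarrow> 0"
    if "0 < \<rho>" for \<rho>
  proof -
    obtain \<delta> \<eta> J where \<delta>: "0 < \<delta>" "\<delta> \<le> 1" "0 < \<eta>"
      and conv: "\<forall>\<beta> k s c x u v. nac_run \<beta> c x u v \<longrightarrow> 0 < \<beta> \<longrightarrow> \<beta> < 1 \<longrightarrow>
       \<delta> / 2 \<le> real k * \<beta> \<longrightarrow> real k * \<beta> \<le> \<delta> \<longrightarrow>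
       (\<forall>i<J. \<forall>a. \<bar>real (card {j. j < k \<and> c (Suc (s + i * k + j)) = a}) - real k * pmf \<mu> a\<bar>
          \<le> \<eta> * real k) \<longrightarrow>
       norm (u (s + J * k) - us, v (s + J * k) - vs) < \<rho>"
      using estimates_converge[OF \<open>0 < \<rho>\<close>] by (elim exE conjE) (rule that)
    define P where "P i n = \<P>(\<omega> in M. norm (Rhat (\<beta> i) n \<omega> - us, Dhat (\<beta> i) n \<omega> - vs) > \<rho>)" for i n
    \<comment> \<open>Union bound over \<open>J\<close> blocks and all states, with
      \<open>1 / k \<le> 2 * \<beta> i / \<delta>\<close>.\<close>
    define \<Phi> where "\<Phi> i = real J * (\<Sum>a\<in>UNIV. \<Gamma> a) * 2 / (\<eta>\<^sup>2 * \<delta>) * \<beta> i" for i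
    \<comment> \<open>A block has at most \<open>\<delta> / \<beta> i\<close> rounds, so
      \<open>J\<close> of them fit before every \<open>n \<ge> nth / \<beta> i\<close>.\<close>
    define nth where "nth = real J * \<delta>"
    \<comment> \<open>The real supremum is meaningful only for a nonempty set that is bounded
      above.\<close>
    have nonempty: "{n. real n \<ge> nth / \<beta> i} \<noteq> {}" for i
      using real_arch_simple[of "nth / \<beta> i"] by auto
    have bdd: "bdd_above (P i ` A)" for i A
      by (rule bdd_aboveI[of _ 1]) (auto simp: P_def)
    have "\<forall>\<^sub>F i in sequentially. \<beta> i < \<delta> / 2"
      using order_tendstoD(2)[OF \<beta>_lim, of "\<delta> / 2"] \<delta> by simp
    then have upper: "\<forall>\<^sub>F i in sequentially. (SUP n\<in>{n. real n \<ge> nth / \<beta> i}. P i n) \<le> \<Phi> i"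
    proof eventually_elim
      case (elim i)
      define k where "k = nat \<lfloor>\<delta> / \<beta> i\<rfloor>"
      have k: "\<delta> / 2 \<le> real k * \<beta> i" "real k * \<beta> i \<le> \<delta>" "0 < k"
        unfolding k_def by (rule block_length; use \<beta> elim in simp)+
      show ?case
      proof (rule cSUP_least[OF nonempty])
        fix n assume "n \<in> {n. real n \<ge> nth / \<beta> i}"
        then have "real J * \<delta> \<le> real n * \<beta> i" using \<beta>[of i] by (simp add: nth_def field_simps)
        moreover have "real J * (real k * \<beta> i) \<le> real J * \<delta>" using k by (intro mult_left_mono) auto
        ultimately have "real (J * k) * \<beta> i \<le> real n * \<beta> i" by simp
        then have "real (J * k) \<le> real n" using \<beta>[of i] by (simp only: mult_le_cancel_right_pos)
        then have Jk: "J * k \<le> n" by (simp only: of_nat_le_iff)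
        \<comment> \<open>The estimates at round \<open>s\<close> are as good as initial values:
          only their bounds enter.\<close>
        define s where "s = n - J * k"
        have n: "n = s + J * k" using Jk by (simp add: s_def)
        have "P i n \<le> \<P>(\<omega> in M. \<exists>i<J. \<exists>a. deviates (pmf \<mu>) \<eta> (s + i * k) k a \<omega>)"
          unfolding P_def
        proof (rule finite_measure_mono)
          show "{\<omega> \<in> space M. \<exists>i<J. \<exists>a. deviates (pmf \<mu>) \<eta> (s + i * k) k a \<omega>} \<in> events"
            by (rule union_deviates(1)[OF \<Gamma>[OF k(3) \<delta>(3)]])
          show "{\<omega> \<in> space M. \<rho> < norm (Rhat (\<beta> i) n \<omega> - us, Dhat (\<beta> i) n \<omega> - vs)} \<subseteq>
              {\<omega> \<in> space M. \<exists>i<J. \<exists>a. deviates (pmf \<mu>) \<eta> (s + i * k) k a \<omega>}"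
          proof (rule subsetI, rule ccontr)
            fix \<omega>
            assume \<omega>: "\<omega> \<in> {\<omega> \<in> space M. \<rho> < norm (Rhat (\<beta> i) n \<omega> - us, Dhat (\<beta> i) n \<omega> - vs)}"
              and nd: "\<omega> \<notin> {\<omega> \<in> space M. \<exists>i<J. \<exists>a. deviates (pmf \<mu>) \<eta> (s + i * k) k a \<omega>}"
            have "norm (Rhat (\<beta> i) (s + J * k) \<omega> - us, Dhat (\<beta> i) (s + J * k) \<omega> - vs) < \<rho>"
            proof (rule conv[rule_format, OF run \<beta> k(1,2)])
              fix b a assume "b < J"
              then have "\<not> deviates (pmf \<mu>) \<eta> (s + b * k) k a \<omega>" using nd \<omega> by blast
              then show "\<bar>real (card {j. j < k \<and> C (Suc (s + b * k + j)) \<omega> = a}) - real k * pmf \<mu> a\<bar>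
                  \<le> \<eta> * real k" by (simp add: deviates_def)
            qed (use \<beta> \<omega> in auto)
            then show False using \<omega> by (simp add: n)
          qed
        qed
        also have "\<dots> \<le> real J * (\<Sum>a\<in>UNIV. \<Gamma> a / (\<eta>\<^sup>2 * real k))"
          by (rule union_deviates(2)[OF \<Gamma>[OF k(3) \<delta>(3)]])
        also have "\<dots> = (real J * (\<Sum>a\<in>UNIV. \<Gamma> a) / \<eta>\<^sup>2) * (1 / real k)"
          by (simp flip: sum_divide_distrib)
        also have "\<dots> \<le> (real J * (\<Sum>a\<in>UNIV. \<Gamma> a) / \<eta>\<^sup>2) * (2 * \<beta> i / \<delta>)"
        proof (rule mult_left_mono)
          show "1 / real k \<le> 2 * \<beta> i / \<delta>" using k \<delta> by (simp add: field_simps)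
        qed (use \<Gamma>0 in \<open>simp add: sum_nonneg\<close>)
        also have "\<dots> = \<Phi> i" by (simp add: \<Phi>_def)
        finally show "P i n \<le> \<Phi> i" .
      qed
    qed
    have lower: "0 \<le> (SUP n\<in>{n. real n \<ge> nth / \<beta> i}. P i n)" for i
    proof -
      obtain n where "n \<in> {n. real n \<ge> nth / \<beta> i}" using nonempty by blast
      then show ?thesis by (rule cSUP_upper2[OF bdd]) (simp add: P_def)
    qed
    have limit: "\<Phi> \<longlonglongrightarrow> 0"
      unfolding \<Phi>_def by (rule tendsto_mult_right_zero[OF \<beta>_lim])
    have "(\<lambda>i. SUP n\<in>{n. real n \<ge> nth / \<beta> i}. P i n) \<longlonglongrightarrow> 0"
      by (rule tendsto_sandwich[OF _ upper tendsto_const limit]) (simp add: lower)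
    then show ?thesis unfolding P_def[abs_def] by (rule exI)
  qed
  then show ?thesis using \<beta> \<beta>_lim unfolding us_def vs_def by (intro exI[of _ \<beta>]) blast
qed

end
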